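(* Let $\mathcal L_n$ be the number of men (equivalently, of women) matched in every stable (possibly partial) matching in the random model with $n$ men, $n$ women, independent uniformly random complete preference lists, and independent admissibility of each pair with probability $p=p(n)\in(0,1)$. Let $c\in(0,1)$ be a constant, suppose $p(n)\le c\,\frac{\log^2 n}{n}$, and set $\Delta_n=n^{1-\sqrt c}\,\log^{-2}n$. Then $$\mathbb{P}(\mathcal L_n\ge n-\Delta_n)\to 0\qquad(n\to\infty)$$ super-polynomially fast, so that with probability tending to $1$ at least $\Delta_n$ men and at least $\Delta_n$ women remain unmatched.
   Context: Model. There are $n$ men and $n$ women. Each man has a preference list which is a permutation (strict linear order) of all $n$ women, and each woman has a preference list which is a permutation of all $n$ men; the $2n$ lists are independent and uniformly random. Independently of the lists, each of the $n^2$ pairs (man, woman) is admissible with probability $p=p(n)$, independently of all other pairs. A (possibly partial) matching $M$ is a set of pairwise disjoint admissible pairs (man, woman). It is called stable if there is no admissible pair $(m,w)\notin M$ such that both: $m$ is unmatched in $M$ or prefers $w$ to his partner in $M$; and $w$ is unmatched in $M$ or prefers $m$ to her partner in $M$. A stable matching always exists, and (Gusfield and Irving) all stable matchings of a given instance match the same set of men and the same set of women. $\mathcal L_n$ denotes the common size (number of pairs) of the stable matchings. A sequence tends to $0$ super-polynomially fast if it is $O(n^{-K})$ for every $K>0$. Inequalities on $p(n)$ are understood to hold for all sufficiently large $n$; $\log$ is the natural logarithm. *)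

theory Defs
  imports
    "HOL-Probability.Probability"
    "HOL-Probability.Product_PMF"
    "HOL-Combinatorics.Multiset_Permutations"
    "HOL-Library.Landau_Symbols"
begin

text \<open>
  Men and women are both indexed by \<open>{..<n}\<close>; a pair \<open>(m, w)\<close> always lists the man first.
  An instance consists of the men's lists \<open>P\<close>, the women's lists \<open>Q\<close> (best partner first) and
  the admissibility relation \<open>A\<close>.
\<close>

definition prefers :: "'a list \<Rightarrow> 'a \<Rightarrow> 'a \<Rightarrow> bool" where
  "prefers xs a b \<longleftrightarrow> (\<exists>i j. i < j \<and> j < length xs \<and> xs ! i = a \<and> xs ! j = b)"

definition matching :: "nat \<Rightarrow> (nat \<times> nat \<Rightarrow> bool) \<Rightarrow> (nat \<times> nat) set \<Rightarrow> bool" where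
  "matching n A M \<longleftrightarrow>
     M \<subseteq> {e \<in> {..<n} \<times> {..<n}. A e} \<and> inj_on fst M \<and> inj_on snd M"

definition blocking ::
  "nat \<Rightarrow> (nat \<Rightarrow> nat list) \<Rightarrow> (nat \<Rightarrow> nat list) \<Rightarrow> (nat \<times> nat \<Rightarrow> bool) \<Rightarrow>
   (nat \<times> nat) set \<Rightarrow> nat \<Rightarrow> nat \<Rightarrow> bool" where
  "blocking n P Q A M m w \<longleftrightarrow>
     m < n \<and> w < n \<and> A (m, w) \<and> (m, w) \<notin> M \<and>
     (m \<notin> fst ` M \<or> (\<exists>w'. (m, w') \<in> M \<and> prefers (P m) w w')) \<and>
     (w \<notin> snd ` M \<or> (\<exists>m'. (m', w) \<in> M \<and> prefers (Q w) m m'))"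

definition stable ::
  "nat \<Rightarrow> (nat \<Rightarrow> nat list) \<Rightarrow> (nat \<Rightarrow> nat list) \<Rightarrow> (nat \<times> nat \<Rightarrow> bool) \<Rightarrow>
   (nat \<times> nat) set \<Rightarrow> bool" where
  "stable n P Q A M \<longleftrightarrow> matching n A M \<and> (\<forall>m w. \<not> blocking n P Q A M m w)"

text \<open>The common size of all stable matchings; see \<open>card_stable\<close> below.\<close>

definition stable_size ::
  "nat \<Rightarrow> (nat \<Rightarrow> nat list) \<Rightarrow> (nat \<Rightarrow> nat list) \<Rightarrow> (nat \<times> nat \<Rightarrow> bool) \<Rightarrow> nat" where
  "stable_size n P Q A = (THE k. \<exists>M. stable n P Q A M \<and> card M = k)"

text \<open>
  Values of the random functions outside the index ranges are fixed to a dummy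
  (\<open>[]\<close> resp.\ \<open>False\<close>).
\<close>

definition random_instance ::
  "nat \<Rightarrow> real \<Rightarrow> ((nat \<Rightarrow> nat list) \<times> (nat \<Rightarrow> nat list) \<times> (nat \<times> nat \<Rightarrow> bool)) pmf" where
  "random_instance n p =
     pair_pmf (Pi_pmf {..<n} [] (\<lambda>_. pmf_of_set (permutations_of_set {..<n})))
       (pair_pmf (Pi_pmf {..<n} [] (\<lambda>_. pmf_of_set (permutations_of_set {..<n})))
         (Pi_pmf ({..<n} \<times> {..<n}) False (\<lambda>_. bernoulli_pmf p)))"

definition super_polynomially_small :: "(nat \<Rightarrow> real) \<Rightarrow> bool" where
  "super_polynomially_small f \<longleftrightarrow> (\<forall>K>0. f \<in> O(\<lambda>n. real n powr (- K)))"


subsection \<open>Well-definedness of the common size\<close>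

lemma prefers_total:
  assumes "xs \<in> permutations_of_set S" "a \<in> S" "b \<in> S" "a \<noteq> b"
  shows "prefers xs a b \<or> prefers xs b a"
proof -
  have "a \<in> set xs" "b \<in> set xs" using assms by (auto simp: permutations_of_set_def)
  then obtain i j where "i < length xs" "xs ! i = a" "j < length xs" "xs ! j = b"
    by (meson in_set_conv_nth)
  then show ?thesis using \<open>a \<noteq> b\<close> unfolding prefers_def
    by (metis linorder_neqE_nat)
qed

lemma prefers_asym:
  assumes "distinct xs" "prefers xs a b" shows "\<not> prefers xs b a"
proof
  assume "prefers xs b a"
  then obtain k l where kl: "k < l" "l < length xs" "xs ! k = b" "xs ! l = a"
    by (auto simp: prefers_def)
  obtain i j where ij: "i < j" "j < length xs" "xs ! i = a" "xs ! j = b"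
    using assms by (auto simp: prefers_def)
  have "i = l" "j = k"
    using kl ij nth_eq_iff_index_eq[OF assms(1), of i l] nth_eq_iff_index_eq[OF assms(1), of j k]
    by auto
  then show False using kl ij by simp
qed

lemma prefers_irrefl: "distinct xs \<Longrightarrow> \<not> prefers xs a a"
  using prefers_asym by metis

lemma prefers_trans:
  assumes "distinct xs" "prefers xs a b" "prefers xs b c" shows "prefers xs a c"
proof -
  obtain i j where ij: "i < j" "j < length xs" "xs ! i = a" "xs ! j = b"
    using assms by (auto simp: prefers_def)
  obtain k l where kl: "k < l" "l < length xs" "xs ! k = b" "xs ! l = c"
    using assms by (auto simp: prefers_def)
  have "j = k"
    using kl ij nth_eq_iff_index_eq[OF assms(1), of j k] by auto
  then show ?thesis using kl ij unfolding prefers_def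
    by (intro exI[of _ i] exI[of _ l]) auto
qed

lemma matching_finite: "matching n A M \<Longrightarrow> finite M"
  unfolding matching_def by (rule finite_subset[of _ "{..<n} \<times> {..<n}"]) auto

lemma matching_uniq:
  assumes "matching n A M"
  shows "(m, w) \<in> M \<Longrightarrow> (m, w') \<in> M \<Longrightarrow> w = w'"
    and "(m, w) \<in> M \<Longrightarrow> (m', w) \<in> M \<Longrightarrow> m = m'"
  using assms inj_onD[of fst M "(m, w)" "(m, w')"] inj_onD[of snd M "(m, w)" "(m', w)"]
  unfolding matching_def by auto

locale preference_lists =
  fixes n :: nat and P Q :: "nat \<Rightarrow> nat list" and A :: "nat \<times> nat \<Rightarrow> bool"
  assumes men: "\<And>m. m < n \<Longrightarrow> P m \<in> permutations_of_set {..<n}"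
    and women: "\<And>w. w < n \<Longrightarrow> Q w \<in> permutations_of_set {..<n}"
begin

lemma distinct_P: "m < n \<Longrightarrow> distinct (P m)"
  using men by (auto simp: permutations_of_set_def)

lemma distinct_Q: "w < n \<Longrightarrow> distinct (Q w)"
  using women by (auto simp: permutations_of_set_def)

lemma total_P: "m < n \<Longrightarrow> a < n \<Longrightarrow> b < n \<Longrightarrow> a \<noteq> b \<Longrightarrow> prefers (P m) a b \<or> prefers (P m) b a"
  using prefers_total[OF men] by auto

lemma total_Q: "w < n \<Longrightarrow> a < n \<Longrightarrow> b < n \<Longrightarrow> a \<noteq> b \<Longrightarrow> prefers (Q w) a b \<or> prefers (Q w) b a"
  using prefers_total[OF women] by auto

lemma matching_lt: "matching n A M \<Longrightarrow> (m, w) \<in> M \<Longrightarrow> m < n \<and> w < n \<and> A (m, w)"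
  by (auto simp: matching_def)

text \<open>If \<open>X\<close> is the set of men strictly better off in \<open>M\<close> than in \<open>M'\<close> and \<open>Y\<close> the set of women
  strictly better off in \<open>M'\<close>, then \<open>M\<close> maps \<open>X\<close> into \<open>Y\<close> and \<open>M'\<close> maps \<open>Y\<close> into \<open>X\<close>.\<close>

lemma stable_men_subset:
  assumes M: "stable n P Q A M" and M': "stable n P Q A M'"
  shows "fst ` M \<subseteq> fst ` M'"
proof -
  have mM: "matching n A M" and mM': "matching n A M'"
    using M M' by (auto simp: stable_def)
  define E where "E = {(m, w) \<in> M. m \<notin> fst ` M' \<or> (\<exists>w'. (m, w') \<in> M' \<and> prefers (P m) w w')}"
  define F where "F = {(m, w) \<in> M'. w \<notin> snd ` M \<or> (\<exists>m'. (m', w) \<in> M \<and> prefers (Q w) m m')}"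
  have EM: "E \<subseteq> M" and FM: "F \<subseteq> M'" by (auto simp: E_def F_def)
  have 1: "\<exists>m'. (m', w) \<in> F" if "(m, w) \<in> E" for m w
  proof -
    have mw: "(m, w) \<in> M" and better: "m \<notin> fst ` M' \<or> (\<exists>w'. (m, w') \<in> M' \<and> prefers (P m) w w')"
      using that by (auto simp: E_def)
    have lt: "m < n" "w < n" "A (m, w)" using matching_lt[OF mM mw] by auto
    have notin: "(m, w) \<notin> M'"
    proof
      assume a: "(m, w) \<in> M'"
      then obtain w' where "(m, w') \<in> M'" "prefers (P m) w w'" using better image_eqI[of m fst "(m, w)" M'] by auto
      then have "prefers (P m) w w" using matching_uniq(1)[OF mM' a] by metis
      then show False using prefers_irrefl[OF distinct_P[OF lt(1)]] by simp
    qed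
    have "\<not> blocking n P Q A M' m w" using M' by (auto simp: stable_def)
    then have "w \<in> snd ` M' \<and> (\<forall>m'. (m', w) \<in> M' \<longrightarrow> \<not> prefers (Q w) m m')"
      using lt notin better by (auto simp: blocking_def)
    then obtain m' where m': "(m', w) \<in> M'" "\<not> prefers (Q w) m m'" by (metis imageE prod.collapse)
    then have "prefers (Q w) m' m"
      using total_Q[of w m m'] lt notin matching_lt[OF mM' m'(1)] by auto
    then show ?thesis using m' mw by (auto simp: F_def)
  qed
  have 2: "\<exists>w'. (m, w') \<in> E" if "(m, w) \<in> F" for m w
  proof -
    have mw: "(m, w) \<in> M'" and better: "w \<notin> snd ` M \<or> (\<exists>m'. (m', w) \<in> M \<and> prefers (Q w) m m')"
      using that by (auto simp: F_def)
    have lt: "m < n" "w < n" "A (m, w)" using matching_lt[OF mM' mw] by auto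
    have notin: "(m, w) \<notin> M"
    proof
      assume a: "(m, w) \<in> M"
      then obtain m' where "(m', w) \<in> M" "prefers (Q w) m m'" using better image_eqI[of w snd "(m, w)" M] by auto
      then have "prefers (Q w) m m" using matching_uniq(2)[OF mM a] by metis
      then show False using prefers_irrefl[OF distinct_Q[OF lt(2)]] by simp
    qed
    have "\<not> blocking n P Q A M m w" using M by (auto simp: stable_def)
    then have "m \<in> fst ` M \<and> (\<forall>w'. (m, w') \<in> M \<longrightarrow> \<not> prefers (P m) w w')"
      using lt notin better by (auto simp: blocking_def)
    then obtain w' where w': "(m, w') \<in> M" "\<not> prefers (P m) w w'" by (metis imageE prod.collapse)
    then have "prefers (P m) w' w"
      using total_P[of m w w'] lt notin matching_lt[OF mM w'(1)] by auto
    then show ?thesis using w' mw by (auto simp: E_def)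
  qed
  have fin: "finite E" "finite F"
    using finite_subset[OF EM] finite_subset[OF FM] matching_finite mM mM' by auto
  have inj: "inj_on fst E" "inj_on snd E" "inj_on fst F" "inj_on snd F"
    using mM mM' EM FM unfolding matching_def by (meson inj_on_subset)+
  have "card E = card (snd ` E)" using inj by (simp add: card_image)
  also have "\<dots> \<le> card (snd ` F)" using 1 fin by (intro card_mono) force+
  also have "\<dots> = card F" using inj by (simp add: card_image)
  also have "\<dots> = card (fst ` F)" using inj by (simp add: card_image)
  finally have "card (fst ` E) \<le> card (fst ` F)" using inj by (simp add: card_image)
  moreover have "fst ` F \<subseteq> fst ` E" using 2 by force
  ultimately have eq: "fst ` F = fst ` E" using fin by (intro card_seteq) auto
  show ?thesis
  proof
    fix m assume "m \<in> fst ` M"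
    then obtain w where mw: "(m, w) \<in> M" by force
    show "m \<in> fst ` M'"
    proof (rule ccontr)
      assume nin: "m \<notin> fst ` M'"
      then have "(m, w) \<in> E" using mw by (auto simp: E_def)
      then have "m \<in> fst ` F" using eq by force
      then show False using nin FM by auto
    qed
  qed
qed

lemma stable_same_men:
  "stable n P Q A M \<Longrightarrow> stable n P Q A M' \<Longrightarrow> fst ` M = fst ` M'"
  using stable_men_subset by blast

lemma stable_same_card:
  assumes "stable n P Q A M" "stable n P Q A M'" shows "card M = card M'"
proof -
  have "card M = card (fst ` M)" "card M' = card (fst ` M')"
    using assms by (auto simp: stable_def matching_def card_image)
  then show ?thesis using stable_same_men[OF assms] by simp
qed

text \<open>Existence: among the matchings whose blocking pairs only involve unmatched men, one that is
  best possible for the women is stable.\<close>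

definition simple :: "(nat \<times> nat) set \<Rightarrow> bool" where
  "simple M \<longleftrightarrow> matching n A M \<and> (\<forall>m w. blocking n P Q A M m w \<longrightarrow> m \<notin> fst ` M)"

definition welfare :: "(nat \<times> nat) set \<Rightarrow> nat" where
  "welfare M = card {(m, w). w < n \<and> m < n \<and> (\<exists>m'. (m', w) \<in> M \<and> (m = m' \<or> prefers (Q w) m' m))}"

lemma welfare_le: "welfare M \<le> n * n"
proof -
  have "welfare M \<le> card ({..<n} \<times> {..<n})" unfolding welfare_def
    by (rule card_mono) auto
  then show ?thesis by simp
qed

lemma best_exists:
  assumes "finite W" "W \<noteq> {}" "W \<subseteq> {..<n}" "m < n"
  shows "\<exists>w\<in>W. \<forall>w'\<in>W. \<not> prefers (P m) w' w"
  using assms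
proof (induction W rule: finite_ne_induct)
  case (singleton x)
  then show ?case using prefers_irrefl[OF distinct_P[of m]] by simp
next
  case (insert x W)
  then obtain w where w: "w \<in> W" "\<forall>w'\<in>W. \<not> prefers (P m) w' w" by auto
  have d: "distinct (P m)" using insert distinct_P by auto
  show ?case
  proof (cases "prefers (P m) x w")
    case True
    have "\<not> prefers (P m) w' x" if "w' \<in> insert x W" for w'
      using that w True prefers_trans[OF d, of w' x w] prefers_irrefl[OF d] by auto
    then show ?thesis by blast
  next
    case False
    then show ?thesis using w by blast
  qed
qed

lemma simple_improve:
  assumes s: "simple M" and ns: "\<not> stable n P Q A M"
  shows "\<exists>M'. simple M' \<and> welfare M < welfare M'"
proof -
  have mM: "matching n A M" using s by (simp add: simple_def)
  then obtain m w0 where b0: "blocking n P Q A M m w0" using ns by (auto simp: stable_def)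
  then have mn: "m < n" and mfree: "m \<notin> fst ` M" using s by (auto simp: simple_def blocking_def)
  define W where "W = {w. blocking n P Q A M m w}"
  have W: "W \<subseteq> {..<n}" by (auto simp: W_def blocking_def)
  then have "finite W" using finite_subset by blast
  then obtain w where bw: "blocking n P Q A M m w"
    and best: "\<And>w'. blocking n P Q A M m w' \<Longrightarrow> \<not> prefers (P m) w' w"
    using best_exists[of W m] W b0 mn unfolding W_def by blast
  have wn: "w < n" and Amw: "A (m, w)" and wpref: "w \<notin> snd ` M \<or> (\<exists>m'. (m', w) \<in> M \<and> prefers (Q w) m m')"
    using bw by (auto simp: blocking_def)
  have dQ: "distinct (Q w)" using distinct_Q wn .
  have wpref': "prefers (Q w) m m'" if "(m', w) \<in> M" for m'
    using wpref image_eqI[of w snd "(m', w)" M] that matching_uniq(2)[OF mM that] by (metis snd_conv)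
  define M' where "M' = insert (m, w) {e \<in> M. snd e \<noteq> w}"
  have mM': "matching n A M'"
    unfolding matching_def
  proof (intro conjI)
    show "M' \<subseteq> {e \<in> {..<n} \<times> {..<n}. A e}"
      using mM mn wn Amw by (auto simp: matching_def M'_def)
    show "inj_on fst M'" "inj_on snd M'"
      using mM mfree inj_on_subset[of _ M "{e \<in> M. snd e \<noteq> w}"]
      by (auto simp: matching_def M'_def)
  qed
  have memM': "(a, b) \<in> M' \<longleftrightarrow> (a = m \<and> b = w) \<or> ((a, b) \<in> M \<and> b \<noteq> w)" for a b
    by (auto simp: M'_def)
  have mnin: "(m, b) \<notin> M" for b using mfree image_eqI[of m fst "(m, b)" M] by auto
  have fstM': "a \<in> fst ` M' \<longleftrightarrow> (\<exists>b. (a, b) \<in> M')" for a by force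
  have sndM': "b \<in> snd ` M' \<longleftrightarrow> (\<exists>a. (a, b) \<in> M')" for b by force
  have fstM: "a \<in> fst ` M \<longleftrightarrow> (\<exists>b. (a, b) \<in> M)" for a by force
  have sndM: "b \<in> snd ` M \<longleftrightarrow> (\<exists>a. (a, b) \<in> M)" for b by force
  have "simple M'"
    unfolding simple_def
  proof (intro conjI allI impI mM' notI)
    fix a b assume bl: "blocking n P Q A M' a b" and "a \<in> fst ` M'"
    then obtain v where v: "(a, v) \<in> M'" "prefers (P a) b v"
      by (auto simp: blocking_def fstM')
    have an: "a < n" and bn: "b < n" and Aab: "A (a, b)" and nin: "(a, b) \<notin> M'"
      and bw': "b \<notin> snd ` M' \<or> (\<exists>m'. (m', b) \<in> M' \<and> prefers (Q b) a m')"
      using bl by (auto simp: blocking_def)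
    have bpref: "b \<notin> snd ` M \<or> (\<exists>m'. (m', b) \<in> M \<and> prefers (Q b) a m')"
    proof (cases "b = w")
      case True
      then have "prefers (Q w) a m" using bw' by (auto simp: memM' sndM')
      then show ?thesis using True wpref' prefers_trans[OF dQ] sndM by metis
    next
      case False
      then show ?thesis using bw' by (auto simp: memM' sndM sndM')
    qed
    have ninM: "(a, b) \<notin> M"
    proof
      assume ab: "(a, b) \<in> M"
      then have "b = w" using nin by (auto simp: memM')
      then have "(a, v) \<in> M" using v ab mnin by (auto simp: memM')
      then have "v = b" using matching_uniq(1)[OF mM ab] by metis
      then show False using v prefers_irrefl[OF distinct_P[OF an]] by simp
    qed
    show False
    proof (cases "a = m")
      case True
      then have "v = w" using v mnin by (auto simp: memM')
      moreover have "blocking n P Q A M m b"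
        using True an bn Aab ninM bpref mfree by (auto simp: blocking_def)
      ultimately show False using best v True by blast
    next
      case False
      then have av: "(a, v) \<in> M" using v by (auto simp: memM')
      then have "blocking n P Q A M a b"
        using an bn Aab ninM bpref v by (auto simp: blocking_def)
      then show False using s av fstM by (auto simp: simple_def)
    qed
  qed
  moreover have "welfare M < welfare M'"
    unfolding welfare_def
  proof (rule psubset_card_mono)
    show "finite {(x, w). w < n \<and> x < n \<and> (\<exists>m'. (m', w) \<in> M' \<and> (x = m' \<or> prefers (Q w) m' x))}"
      by (rule finite_subset[of _ "{..<n} \<times> {..<n}"]) auto
    let ?S = "\<lambda>N. {(x, w). w < n \<and> x < n \<and> (\<exists>m'. (m', w) \<in> N \<and> (x = m' \<or> prefers (Q w) m' x))}"
    have "?S M \<subseteq> ?S M'"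
    proof
      fix e assume "e \<in> ?S M"
      then obtain x b m' where e: "e = (x, b)"
        and h: "b < n" "x < n" "(m', b) \<in> M" "x = m' \<or> prefers (Q b) m' x" by auto
      have "\<exists>m'. (m', b) \<in> M' \<and> (x = m' \<or> prefers (Q b) m' x)"
      proof (cases "b = w")
        case True
        then have "prefers (Q w) m m'" using wpref' h by auto
        then have "prefers (Q b) m x" using h True prefers_trans[OF dQ] by auto
        then show ?thesis using h True by (auto simp: memM')
      next
        case False
        then show ?thesis using h by (auto simp: memM')
      qed
      then show "e \<in> ?S M'" using e h by auto
    qed
    moreover have "(m, w) \<in> ?S M'" using mn wn by (auto simp: memM')
    moreover have "(m, w) \<notin> ?S M"
      using wpref' mnin prefers_asym[OF dQ] by auto
    ultimately show "?S M \<subset> ?S M'" by blast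
  qed
  ultimately show ?thesis by blast
qed

lemma stable_exists: "\<exists>M. stable n P Q A M"
proof (rule ccontr)
  assume no: "\<not> ?thesis"
  have "\<exists>M. simple M \<and> k \<le> welfare M" for k
  proof (induction k)
    case 0
    have "simple {}" by (auto simp: simple_def matching_def)
    then show ?case by auto
  next
    case (Suc k)
    then show ?case using simple_improve no by (meson Suc_leI le_less_trans)
  qed
  then obtain M where "Suc (n * n) \<le> welfare M" by blast
  then show False using welfare_le[of M] by simp
qed

lemma card_stable:
  assumes "stable n P Q A M" shows "card M = stable_size n P Q A"
  unfolding stable_size_def
  by (rule sym, rule the_equality) (use assms stable_same_card in blast)+

end

end

theory Submission
  imports Defs "HOL-Real_Asymp.Real_Asymp"
begin

text \<open>
  First moment method. Fix a set \<open>M\<close> of \<open>l\<close> disjoint pairs. Representing preference lists by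
  independent uniform scores, \<open>M\<close> is stable with probability at most
  \<open>p\<^sup>l \<integral>\<integral> \<Prod>\<^bsub>i \<noteq> j\<^esub> (1 - p x\<^sub>i y\<^sub>j) dx dy\<close> over the cubes \<open>x, y \<in> [0,1]\<^sup>l\<close>. Bounding the factors by
  exponentials and integrating over \<open>y\<close> gives, up to the factor \<open>exp (p l)\<close>, the integral over \<open>x\<close> of
  \<open>((1 - exp (- p s)) / s)\<^sup>l\<close> with \<open>s = \<Sum> x\<^sub>i\<close>. After multiplication by \<open>l!\<close>, the part of the cube
  where \<open>s\<close> is close to \<open>j\<close> contributes roughly
  \<open>((1 - exp (- p j)) (1 - exp (- l / j)))\<^sup>l\<close>. The product of the two exponents is \<open>p l \<le> c ln\<^sup>2 n\<close>,
  so one of them is at most \<open>\<surd>c ln n\<close> and the contribution is at most about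
  \<open>exp (- l n powr (- \<surd>c))\<close>. For \<open>l \<ge> n - \<Delta>\<close> this beats the \<open>(n choose l)\<^sup>2 \<le> exp (2 \<Delta> ln n)\<close> choices
  of the matched men and women, because \<open>\<Delta> ln n = n powr (1 - \<surd>c) / ln n\<close>.
\<close>

section \<open>Averages over the cube\<close>

text \<open>A non-asymptotic Stirling bound, by induction from
  \<open>(1 - 1 / (l + 1)) ^ (l + 1) \<le> exp (- 1)\<close>. It lets \<open>l!\<close> cancel the
  factor \<open>exp l / l ^ l\<close> that tilting produces, at the cost of a factor linear in
  \<open>l\<close>.\<close>

lemma fact_mult_exp_le:
  assumes "l \<ge> 1"
  shows "fact l * exp (real l) \<le> exp 1 * real l * real l ^ l"
  using assms
proof (induction l rule: dec_induct)
  case base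
  then show ?case by simp
next
  case (step l)
  have "(1 - 1 / real (Suc l)) ^ Suc l \<le> exp (- 1 / real (Suc l)) ^ Suc l"
    using exp_ge_add_one_self[of "- 1 / real (Suc l)"] by (intro power_mono) (auto simp: field_simps)
  also have "\<dots> = exp (- 1)"
    by (subst exp_of_nat_mult[symmetric]) simp
  also have "1 - 1 / real (Suc l) = real l / real (Suc l)"
    by (simp add: field_simps)
  finally have "exp 1 * real l ^ Suc l \<le> real (Suc l) ^ Suc l"
    by (simp add: power_divide exp_minus field_simps del: power_Suc of_nat_Suc)
  then have h: "real l * real l ^ l * exp 1 \<le> real (Suc l) ^ Suc l" by (simp add: mult.commute)
  have "fact (Suc l) * exp (real (Suc l)) = (fact l * exp (real l)) * (real (Suc l) * exp 1)"
    by (simp add: exp_add algebra_simps)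
  also have "\<dots> \<le> (exp 1 * real l * real l ^ l) * (real (Suc l) * exp 1)"
    using step.IH by (intro mult_right_mono) auto
  also have "\<dots> = exp 1 * real (Suc l) * (real l * real l ^ l * exp 1)" by (simp add: mult_ac)
  also have "\<dots> \<le> exp 1 * real (Suc l) * real (Suc l) ^ Suc l"
    using h by (intro mult_left_mono) auto
  finally show ?case .
qed

text \<open>The left Riemann sum is geometric with ratio \<open>exp (- h)\<close>, where
  \<open>h = \<theta> / N\<close>, and \<open>h * exp (- h) \<le> 1 - exp (- h)\<close>. So it
  exceeds the integral over [0, 1] by at most the factor \<open>exp h\<close>.\<close>

lemma sum_exp_grid_le:
  fixes \<theta> :: real
  assumes N: "N > 0" and \<theta>: "\<theta> > 0"
  shows "(\<Sum>k<N. exp (- \<theta> * (real k / real N))) / real N \<le> exp (\<theta> / real N) * ((1 - exp (- \<theta>)) / \<theta>)"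
proof -
  define h where "h = \<theta> / real N"
  have h: "h > 0" using assms by (simp add: h_def)
  have "(\<Sum>k<N. exp (- \<theta> * (real k / real N))) = (\<Sum>k<N. exp (- h) ^ k)"
    by (intro sum.cong) (simp_all add: h_def flip: exp_of_nat_mult)
  also have "\<dots> = (1 - exp (- h) ^ N) / (1 - exp (- h))"
    using h by (subst sum_gp_strict) auto
  also have "exp (- h) ^ N = exp (- \<theta>)"
    using N by (simp add: h_def flip: exp_of_nat_mult)
  finally have eq: "(\<Sum>k<N. exp (- \<theta> * (real k / real N))) = (1 - exp (- \<theta>)) / (1 - exp (- h))" .
  have "h * exp (- h) \<le> 1 - exp (- h)"
    using exp_ge_add_one_self[of h] by (simp add: exp_minus field_simps)
  then have "(1 - exp (- \<theta>)) / (1 - exp (- h)) \<le> (1 - exp (- \<theta>)) / (h * exp (- h))"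
    using h \<theta> by (intro divide_left_mono mult_pos_pos) auto
  also have "\<dots> = real N * (exp h * ((1 - exp (- \<theta>)) / \<theta>))"
    using N \<theta> by (simp add: h_def exp_minus field_simps)
  finally show ?thesis
    unfolding eq h_def[symmetric] using N by (subst pos_divide_le_eq) (simp_all only: mult.commute of_nat_0_less_iff)
qed

text \<open>The Laplace transform of the uniform distribution on [0, 1]. The integral form covers
  every real argument: the value 1 at 0 and the negative arguments that can arise when a summand is
  dropped.\<close>

definition phi :: "real \<Rightarrow> real" where
  "phi S = integral {0..1} (\<lambda>y. exp (- (S * y)))"

lemma phi_integrable: "(\<lambda>y::real. exp (- (S * y))) integrable_on {0..1}"
  by (intro integrable_continuous_interval continuous_intros)

lemma phi_antimono: "S \<le> T \<Longrightarrow> phi T \<le> phi S"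
  unfolding phi_def by (intro integral_le phi_integrable) (auto intro: mult_right_mono)

lemma phi_nonneg: "phi S \<ge> 0"
  unfolding phi_def by (intro integral_nonneg phi_integrable) auto

lemma phi_0: "phi 0 = 1"
  by (simp add: phi_def)

lemma phi_eq: 
  assumes "S > 0" shows "phi S = (1 - exp (- S)) / S"
proof -
  have "((\<lambda>y. exp (- (S * y))) has_integral (- exp (- (S * 1)) / S - - exp (- (S * 0)) / S)) {0..1}"
    using assms by (intro fundamental_theorem_of_calculus) 
      (auto intro!: derivative_eq_intros simp: has_real_derivative_iff_has_vector_derivative[symmetric])
  then show ?thesis using assms by (simp add: phi_def integral_unique diff_divide_distrib)
qed

text \<open>Since \<open>exp (d * y) \<le> exp d\<close> on [0, 1]. This absorbs the pair
  \<open>e = f\<close> that is missing from the double product over a matching.\<close>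

lemma phi_diff_le:
  assumes "d \<ge> 0" shows "phi (S - d) \<le> exp d * phi S"
proof -
  have "phi (S - d) \<le> integral {0..1} (\<lambda>y. exp d * exp (- (S * y)))"
    unfolding phi_def
  proof (intro integral_le phi_integrable)
    show "(\<lambda>y. exp d * exp (- (S * y))) integrable_on {0..1}"
      using integrable_on_cmult_left[OF phi_integrable] by simp
    fix y :: real assume "y \<in> {0..1}"
    then have "d * y \<le> d" using assms by (simp add: mult_left_le)
    then show "exp (- ((S - d) * y)) \<le> exp d * exp (- (S * y))"
      by (simp add: algebra_simps flip: exp_add)
  qed
  then show ?thesis by (simp add: phi_def)
qed

text \<open>Exponential tilting: on the window \<open>[j, j + 1)\<close> the weight \<open>exp (\<theta> (j + 1 - s))\<close> is at least 1,
  and \<open>\<theta> = l / j\<close> is the choice that makes its average over the cube nearly optimal.\<close>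

lemma phi_power_le_windows:
  fixes p s :: real
  assumes p: "p > 0" and s: "0 \<le> s" "s \<le> real l" and b: "b \<ge> 1"
  shows "(p * phi (p * s)) ^ l \<le> p ^ l * exp (real l / real b * (real b - s))
    + (\<Sum>j=b..l. ((1 - exp (- (p * real j))) / real j) ^ l * exp (real l / real j * (real j + 1 - s)))"
proof (cases "s < real b")
  \<comment> \<open>Below the cut-off \<open>b\<close> the trivial bound \<open>phi \<le> 1\<close>
    suffices, and the weight with exponent \<open>l / b * (b - s)\<close> is at least 1.\<close>
  case True
  have "phi (p * s) \<le> 1" using phi_antimono[of 0 "p * s"] p s by (simp add: phi_0)
  then have "(p * phi (p * s)) ^ l \<le> p ^ l * 1"
    using p by (simp add: power_mult_distrib power_le_one phi_nonneg mult_left_le)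
  also have "\<dots> \<le> p ^ l * exp (real l / real b * (real b - s))"
    using True p by (intro mult_left_mono) auto
  also have "\<dots> \<le> p ^ l * exp (real l / real b * (real b - s))
    + (\<Sum>j=b..l. ((1 - exp (- (p * real j))) / real j) ^ l * exp (real l / real j * (real j + 1 - s)))"
    using p by (intro add_increasing2 sum_nonneg mult_nonneg_nonneg zero_le_power divide_nonneg_nonneg) auto
  finally show ?thesis .
next
  case False
  \<comment> \<open>The window containing \<open>s\<close>; by monotonicity \<open>phi\<close> is at
    most its value at the left end.\<close>
  define j where "j = nat \<lfloor>s\<rfloor>"
  have j: "real j \<le> s" "s < real j + 1" "j \<in> {b..l}"
    using False s by (auto simp: j_def le_nat_floor) linarith+
  have j0: "j > 0" using j b by auto
  have "(p * phi (p * s)) ^ l \<le> (p * phi (p * real j)) ^ l"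
    using p j by (intro power_mono mult_left_mono phi_antimono mult_nonneg_nonneg phi_nonneg) auto
  also have "\<dots> = ((1 - exp (- (p * real j))) / real j) ^ l * 1"
    using p j0 by (simp add: phi_eq)
  also have "((1 - exp (- (p * real j))) / real j) ^ l * 1 \<le> ((1 - exp (- (p * real j))) / real j) ^ l * exp (real l / real j * (real j + 1 - s))"
    using j p by (intro mult_left_mono zero_le_power divide_nonneg_nonneg) auto
  also have "\<dots> \<le> (\<Sum>j=b..l. ((1 - exp (- (p * real j))) / real j) ^ l * exp (real l / real j * (real j + 1 - s)))"
    using j p by (intro member_le_sum) (auto intro!: mult_nonneg_nonneg zero_le_power divide_nonneg_nonneg)
  also have "\<dots> \<le> p ^ l * exp (real l / real b * (real b - s)) + \<dots>"
    using p by (intro add_increasing) auto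
  finally show ?thesis .
qed

text \<open>The exponential of a sum factorises, so the average over the cube is the
  \<open>l\<close>-th power of a one-dimensional one. As \<open>\<theta> = l / j\<close> is at most
  \<open>l\<close>, a grid with \<open>N \<ge> l\<^sup>2\<close> points per axis keeps the
  accumulated discretisation error \<open>exp (\<theta> / N) ^ l\<close> below
  \<open>exp 1\<close>.\<close>

lemma sum_exp_PiE_grid_le:
  assumes "finite I" "card I = l" "l \<ge> 1" "N \<ge> l\<^sup>2" "j \<ge> 1"
  shows "(\<Sum>k\<in>PiE I (\<lambda>_. {..<N}). exp (- (real l / real j) * (\<Sum>i\<in>I. real (k i) / real N))) / real N ^ l
    \<le> exp 1 * ((1 - exp (- (real l / real j))) * (real j / real l)) ^ l"
proof -
  define \<theta> where "\<theta> = real l / real j"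
  have N: "N > 0" using assms by (metis gr0I le_zero_eq not_one_le_zero power_not_zero)
  have \<theta>: "\<theta> > 0" "\<theta> \<le> real l" using assms by (auto simp: \<theta>_def field_simps)
  have "(\<Sum>k\<in>PiE I (\<lambda>_. {..<N}). exp (- \<theta> * (\<Sum>i\<in>I. real (k i) / real N)))
    = (\<Sum>k\<in>PiE I (\<lambda>_. {..<N}). \<Prod>i\<in>I. exp (- \<theta> * (real (k i) / real N)))"
    using assms by (simp add: exp_sum sum_distrib_left sum_negf flip: sum_negf)
  also have "\<dots> = (\<Prod>i\<in>I. \<Sum>k<N. exp (- \<theta> * (real k / real N)))"
    using assms by (subst prod_sum_PiE) auto
  also have "\<dots> = (\<Sum>k<N. exp (- \<theta> * (real k / real N))) ^ l"
    using assms by simp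
  finally have "(\<Sum>k\<in>PiE I (\<lambda>_. {..<N}). exp (- \<theta> * (\<Sum>i\<in>I. real (k i) / real N))) / real N ^ l
     = ((\<Sum>k<N. exp (- \<theta> * (real k / real N))) / real N) ^ l"
    by (simp add: power_divide)
  also have "\<dots> \<le> (exp (\<theta> / real N) * ((1 - exp (- \<theta>)) / \<theta>)) ^ l"
    using sum_exp_grid_le[OF N \<theta>(1)] by (intro power_mono) (auto intro!: sum_nonneg divide_nonneg_nonneg)
  also have "\<dots> = exp (real l * (\<theta> / real N)) * ((1 - exp (- \<theta>)) / \<theta>) ^ l"
    by (simp only: power_mult_distrib exp_of_nat_mult)
  also have "\<dots> \<le> exp 1 * ((1 - exp (- \<theta>)) / \<theta>) ^ l"
  proof (intro mult_right_mono)
    have "real l * \<theta> \<le> real l * real l" using \<theta> by (intro mult_left_mono) auto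
    also have "\<dots> \<le> real N" using assms(4) by (metis of_nat_le_iff of_nat_mult power2_eq_square)
    finally show "exp (real l * (\<theta> / real N)) \<le> exp 1" using N by (simp add: field_simps)
  qed (use \<theta> in auto)
  finally show ?thesis by (simp add: \<theta>_def)
qed

text \<open>\<open>(1 / 2) ^ l\<close> accounts for the part of the cube with coordinate sum below
  \<open>b\<close>, the other summand for at most \<open>l\<close> windows of unit width. Of
  \<open>exp 2\<close>, one factor \<open>exp 1\<close> is the discretisation error and one comes
  from Stirling.\<close>

definition moment_bound :: "real \<Rightarrow> nat \<Rightarrow> nat \<Rightarrow> real" where
  "moment_bound q b l =
     exp 2 * real l * ((1 / 2) ^ l + real l * exp (real l / real b) * (1 - exp (- q)) ^ l)"

text \<open>For every window, \<open>p j \<cdot> l / j = p l \<le> q\<^sup>2\<close>, so one of the two factors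
  \<open>1 - exp (- p j)\<close> and \<open>1 - exp (- l / j)\<close> is at most \<open>1 - exp (- q)\<close>.\<close>

lemma grid_average_phi_power_le:
  fixes p q :: real
  assumes I: "finite I" "card I = l" and l: "l \<ge> 1" and N: "N \<ge> l\<^sup>2" and b: "b \<ge> 1"
    and p: "p > 0" and pb: "p * real b \<le> 1 / 2" and q: "q \<ge> 0" "p * real l \<le> q\<^sup>2"
  shows "fact l * ((\<Sum>k\<in>PiE I (\<lambda>_. {..<N}). (p * phi (p * (\<Sum>i\<in>I. real (k i) / real N))) ^ l) / real N ^ l)
    \<le> moment_bound q b l"
proof -
  let ?s = "\<lambda>k. \<Sum>i\<in>I. real (k i) / real N"
  let ?K = "PiE I (\<lambda>_. {..<N})"
  let ?E = "\<lambda>j. (\<Sum>k\<in>?K. exp (- (real l / real j) * ?s k)) / real N ^ l"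
  define g where "g j = ((1 - exp (- (p * real j))) / real j) ^ l" for j :: nat
  \<comment> \<open>Common to all terms: \<open>exp l\<close> comes from the tilt and
    \<open>1 / l ^ l\<close> from the averages \<open>(j / l) ^ l\<close>, whose
    \<open>j ^ l\<close> cancels the denominator of \<open>g j\<close>.\<close>
  define R where "R = exp (real l) / real l ^ l"
  have N0: "N > 0" using l N by (metis gr0I le_zero_eq not_one_le_zero power_not_zero)
  have g: "g j \<ge> 0" for j using p by (auto simp: g_def intro!: zero_le_power divide_nonneg_nonneg)
  have R: "R \<ge> 0" by (simp add: R_def)
  have s: "0 \<le> ?s k" "?s k \<le> real l" if "k \<in> ?K" for k
  proof -
    have "?s k \<le> (\<Sum>i\<in>I. 1)" using that N0 by (intro sum_mono) (auto simp: PiE_def Pi_def intro: less_imp_le)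
    then show "?s k \<le> real l" using I by simp
  qed (auto intro: sum_nonneg)
  have "(\<Sum>k\<in>?K. (p * phi (p * ?s k)) ^ l) \<le> 
    (\<Sum>k\<in>?K. p ^ l * exp (real l) * exp (- (real l / real b) * ?s k)
       + (\<Sum>j=b..l. g j * (exp (real l + real l / real j) * exp (- (real l / real j) * ?s k))))"
  proof (intro sum_mono)
    fix k assume k: "k \<in> ?K"
    have "real l / real b * (real b - ?s k) = real l + - (real l / real b) * ?s k"
      using b by (simp add: field_simps)
    moreover have "real l / real j * (real j + 1 - ?s k) = real l + real l / real j + - (real l / real j) * ?s k"
      if "j \<in> {b..l}" for j using b that by (simp add: field_simps)
    ultimately show "(p * phi (p * ?s k)) ^ l \<le> p ^ l * exp (real l) * exp (- (real l / real b) * ?s k)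
       + (\<Sum>j=b..l. g j * (exp (real l + real l / real j) * exp (- (real l / real j) * ?s k)))"
      using phi_power_le_windows[OF p s[OF k] b] 
      by (simp only: g_def mult.assoc exp_add[symmetric] cong: sum.cong)
  qed
  also have "\<dots> = p ^ l * exp (real l) * (\<Sum>k\<in>?K. exp (- (real l / real b) * ?s k))
     + (\<Sum>j=b..l. \<Sum>k\<in>?K. g j * (exp (real l + real l / real j) * exp (- (real l / real j) * ?s k)))"
    by (simp only: sum.distrib sum_distrib_left sum.swap[of _ ?K])
  finally have "(\<Sum>k\<in>?K. (p * phi (p * ?s k)) ^ l) / real N ^ l \<le> 
    (p ^ l * exp (real l) * (\<Sum>k\<in>?K. exp (- (real l / real b) * ?s k))
     + (\<Sum>j=b..l. \<Sum>k\<in>?K. g j * (exp (real l + real l / real j) * exp (- (real l / real j) * ?s k)))) / real N ^ l"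
    by (rule divide_right_mono) simp
  also have "\<dots> = p ^ l * exp (real l) * ?E b + (\<Sum>j=b..l. g j * exp (real l + real l / real j) * ?E j)"
    by (simp only: mult.assoc sum_distrib_left[symmetric] add_divide_distrib sum_divide_distrib[of _ "{b..l}"] times_divide_eq_right)
  also have "\<dots> \<le> exp 1 * R * (1 / 2) ^ l + (\<Sum>j=b..l. exp 1 * R * (exp (real l / real b) * (1 - exp (- q)) ^ l))"
  proof (intro add_mono sum_mono)
    have "p ^ l * exp (real l) * ?E b \<le> p ^ l * exp (real l) * (exp 1 * ((1 - exp (- (real l / real b))) * (real b / real l)) ^ l)"
      using p by (intro mult_left_mono sum_exp_PiE_grid_le I l N b) auto
    \<comment> \<open>Dropping \<open>1 - exp (- l / b)\<close> leaves \<open>(p * b) ^ l\<close>,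
      which the assumption \<open>p * b \<le> 1 / 2\<close> makes exponentially small.\<close>
    also have "\<dots> \<le> p ^ l * exp (real l) * (exp 1 * (1 * (real b / real l)) ^ l)"
      using p by (intro mult_left_mono power_mono mult_right_mono) auto
    also have "\<dots> = exp 1 * R * (p * real b) ^ l"
      by (simp add: R_def power_mult_distrib power_divide)
    also have "\<dots> \<le> exp 1 * R * (1 / 2) ^ l"
      using pb p R by (intro mult_left_mono power_mono) auto
    finally show "p ^ l * exp (real l) * ?E b \<le> exp 1 * R * (1 / 2) ^ l" .
  next
    fix j assume j: "j \<in> {b..l}"
    then have j1: "j \<ge> 1" using b by auto
    have "g j * exp (real l + real l / real j) * ?E j \<le> g j * exp (real l + real l / real j) *
        (exp 1 * ((1 - exp (- (real l / real j))) * (real j / real l)) ^ l)"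
      using g by (intro mult_left_mono sum_exp_PiE_grid_le I l N j1) auto
    also have "\<dots> = exp 1 * R * (exp (real l / real j) * ((1 - exp (- (p * real j))) * (1 - exp (- (real l / real j)))) ^ l)"
      using j1 by (simp add: R_def g_def power_mult_distrib power_divide exp_add)
    also have "\<dots> \<le> exp 1 * R * (exp (real l / real b) * (1 - exp (- q)) ^ l)"
    proof (intro mult_left_mono mult_mono power_mono)
      \<comment> \<open>\<open>exp (l / j)\<close> is the price of windows of unit width; the
        cut-off \<open>b\<close> keeps it under control.\<close>
      show "exp (real l / real j) \<le> exp (real l / real b)"
        using j b by (auto intro!: divide_left_mono)
      have "p * real j \<le> q \<or> real l / real j \<le> q"
      proof (rule ccontr)
        assume "\<not> ?thesis"
        then have "q * q < (p * real j) * (real l / real j)" using q by (intro mult_strict_mono) auto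
        then show False using q j1 by (simp add: power2_eq_square)
      qed
      then show "(1 - exp (- (p * real j))) * (1 - exp (- (real l / real j))) \<le> 1 - exp (- q)"
      proof
        assume "p * real j \<le> q"
        then have "(1 - exp (- (p * real j))) * (1 - exp (- (real l / real j))) \<le> (1 - exp (- q)) * 1"
          using p q by (intro mult_mono) auto
        then show ?thesis by simp
      next
        assume "real l / real j \<le> q"
        then have "(1 - exp (- (p * real j))) * (1 - exp (- (real l / real j))) \<le> 1 * (1 - exp (- q))"
          using p q by (intro mult_mono) auto
        then show ?thesis by simp
      qed
    qed (use p q R in auto)
    finally show "g j * exp (real l + real l / real j) * ?E j \<le> exp 1 * R * (exp (real l / real b) * (1 - exp (- q)) ^ l)" .
  qed
  also have "\<dots> \<le> exp 1 * R * (1 / 2) ^ l + real l * (exp 1 * R * (exp (real l / real b) * (1 - exp (- q)) ^ l))"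
    using b q R by (auto intro!: mult_right_mono)
  also have "\<dots> = exp 1 * R * ((1 / 2) ^ l + real l * exp (real l / real b) * (1 - exp (- q)) ^ l)"
    by (simp add: algebra_simps)
  finally have "fact l * ((\<Sum>k\<in>?K. (p * phi (p * ?s k)) ^ l) / real N ^ l) \<le> 
    fact l * (exp 1 * R * ((1 / 2) ^ l + real l * exp (real l / real b) * (1 - exp (- q)) ^ l))"
    by (rule mult_left_mono) simp
  also have "\<dots> = (exp 1 * (fact l * R)) * ((1 / 2) ^ l + real l * exp (real l / real b) * (1 - exp (- q)) ^ l)"
    by simp
  also have "\<dots> \<le> (exp 1 * (exp 1 * real l)) * ((1 / 2) ^ l + real l * exp (real l / real b) * (1 - exp (- q)) ^ l)"
  proof (intro mult_right_mono mult_left_mono)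
    show "fact l * R \<le> exp 1 * real l"
      using fact_mult_exp_le[OF l] l by (simp add: R_def field_simps)
  qed (use q in auto)
  also have "exp 1 * (exp 1 * real l) = exp 2 * real l" by (simp flip: exp_add)
  finally show ?thesis unfolding moment_bound_def .
qed

section \<open>Uniformly random preference lists\<close>

lemma prefers_map:
  "prefers L a b \<Longrightarrow> prefers (map f L) (f a) (f b)"
  by (fastforce simp: prefers_def)

lemma prefers_rev: "prefers (rev L) a b \<longleftrightarrow> prefers L b a"
proof -
  have "prefers (rev L) a b" if h: "prefers L b a" for L :: "'a list" and a b
  proof -
    obtain i j where "i < j" "j < length L" "L ! i = b" "L ! j = a"
      using h by (auto simp: prefers_def)
    then show ?thesis unfolding prefers_def
      by (intro exI[of _ "length L - 1 - j"] exI[of _ "length L - 1 - i"]) (auto simp: rev_nth)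
  qed
  from this[of L b a] this[of "rev L" a b] show ?thesis by auto
qed

text \<open>By symmetry each element of \<open>E = insert w D\<close> is equally often the first of
  \<open>E\<close> to occur: the classes \<open>X a\<close> partition the permutations, and swapping
  the names \<open>a\<close> and \<open>b\<close> maps \<open>X a\<close> injectively into
  \<open>X b\<close>.\<close>

lemma card_permutations_first:
  assumes S: "finite S" and w: "w \<in> S" and D: "D \<subseteq> S - {w}"
  shows "card {L \<in> permutations_of_set S. \<forall>d\<in>D. prefers L w d} * (card D + 1) = card (permutations_of_set S)"
proof -
  define E where "E = insert w D"
  define X where "X a = {L \<in> permutations_of_set S. \<forall>d\<in>E - {a}. prefers L a d}" for a
  have E: "finite E" "E \<subseteq> S" "card E = card D + 1"
    using w D finite_subset[OF D] S by (auto simp: E_def card_insert_if)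
  have finX: "finite (X a)" for a by (simp add: X_def)
  have le: "card (X a) \<le> card (X b)" if "a \<in> E" "b \<in> E" for a b
  proof (rule card_inj_on_le[where f = "map (Transposition.transpose a b)"])
    show "inj_on (map (Transposition.transpose a b)) (X a)"
      by (intro inj_on_subset[OF inj_mapI]) auto
    show "map (Transposition.transpose a b) ` X a \<subseteq> X b"
    proof
      fix L' assume "L' \<in> map (Transposition.transpose a b) ` X a"
      then obtain L where L: "L \<in> X a" "L' = map (Transposition.transpose a b) L" by auto
      have "L' \<in> permutations_of_set S"
        using L E that by (auto simp: X_def permutations_of_set_def distinct_map Transposition.transpose_def
          image_iff inj_on_def split: if_splits)
      moreover have "prefers L' b d" if d: "d \<in> E - {b}" for d
      proof -
        have "Transposition.transpose a b d \<in> E - {a}"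
          using d \<open>a \<in> E\<close> \<open>b \<in> E\<close> by (auto simp: Transposition.transpose_def)
        then have "prefers L a (Transposition.transpose a b d)" using L by (auto simp: X_def)
        from prefers_map[OF this, of "Transposition.transpose a b"] show ?thesis by (simp add: L)
      qed
      ultimately show "L' \<in> X b" by (auto simp: X_def)
    qed
  qed (rule finX)
  have "permutations_of_set S = (\<Union>a\<in>E. X a)"
  proof
    show "permutations_of_set S \<subseteq> (\<Union>a\<in>E. X a)"
    proof
      fix L assume L: "L \<in> permutations_of_set S"
      then have Ls: "set L = S" "distinct L" by (auto simp: permutations_of_set_def)
      \<comment> \<open>The earliest position holding an element of \<open>E\<close>; its entry
        precedes the rest of \<open>E\<close>.\<close>
      define i where "i = (LEAST i. i < length L \<and> L ! i \<in> E)"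
      have "\<exists>i. i < length L \<and> L ! i \<in> E"
        using w Ls by (auto simp: E_def in_set_conv_nth)
      then have i: "i < length L" "L ! i \<in> E" unfolding i_def by (metis (mono_tags, lifting) LeastI)+
      have "prefers L (L ! i) d" if "d \<in> E - {L ! i}" for d
      proof -
        have "d \<in> set L" using that E Ls by auto
        then obtain j where j: "j < length L" "L ! j = d" by (auto simp: in_set_conv_nth)
        have "i \<le> j" unfolding i_def using j that by (intro Least_le) auto
        moreover have "i \<noteq> j" using that j by auto
        ultimately show ?thesis using j unfolding prefers_def by (metis le_neq_implies_less)
      qed
      then show "L \<in> (\<Union>a\<in>E. X a)" using i L by (auto simp: X_def)
    qed
  qed (auto simp: X_def)
  then have "card (permutations_of_set S) = (\<Sum>a\<in>E. card (X a))"
  proof (simp only:, intro card_UN_disjoint ballI impI)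
    fix a b assume "a \<in> E" "b \<in> E" "a \<noteq> b"
    show "X a \<inter> X b = {}"
    proof (rule ccontr)
      assume "X a \<inter> X b \<noteq> {}"
      then obtain L where "L \<in> X a" "L \<in> X b" by blast
      with \<open>a \<in> E\<close> \<open>b \<in> E\<close> \<open>a \<noteq> b\<close> have "distinct L" "prefers L a b" "prefers L b a"
        by (auto simp: X_def permutations_of_set_def)
      then show False using prefers_asym by metis
    qed
  qed (use E finX in auto)
  also have "\<dots> = (\<Sum>a\<in>E. card (X w))"
    using le by (intro sum.cong) (auto simp: E_def intro: antisym)
  finally have "card (permutations_of_set S) = (card D + 1) * card (X w)" using E by simp
  moreover have "E - {w} = D" using D by (auto simp: E_def)
  ultimately show ?thesis by (simp add: X_def)
qed

lemma prob_permutation_first: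
  assumes "finite S" "w \<in> S" "D \<subseteq> S - {w}"
  shows "measure_pmf.prob (pmf_of_set (permutations_of_set S)) {L. \<forall>d\<in>D. prefers L w d} = 1 / (real (card D) + 1)"
proof -
  have "real (card {L \<in> permutations_of_set S. \<forall>d\<in>D. prefers L w d}) * (real (card D) + 1) =
    real (card (permutations_of_set S))"
    using arg_cong[OF card_permutations_first[OF assms], of real] by (simp add: algebra_simps)
  moreover have "card (permutations_of_set S) > 0" using assms by (simp add: card_gt_0_iff)
  ultimately show ?thesis using assms
    by (subst measure_pmf_of_set) (auto simp: Int_def field_simps)
qed

text \<open>Reversing a uniformly random permutation leaves its distribution unchanged.\<close>

lemma prob_permutation_last:
  assumes "finite S" "w \<in> S" "D \<subseteq> S - {w}"
  shows "measure_pmf.prob (pmf_of_set (permutations_of_set S)) {L. \<forall>d\<in>D. prefers L d w} = 1 / (real (card D) + 1)"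
proof -
  have "bij_betw rev (permutations_of_set S) (permutations_of_set S)"
    by (rule bij_betwI[of _ _ _ rev]) (auto simp: permutations_of_set_def)
  then have "map_pmf rev (pmf_of_set (permutations_of_set S)) = pmf_of_set (permutations_of_set S)"
    using assms by (intro map_pmf_of_set_bij_betw) auto
  then have "measure_pmf.prob (pmf_of_set (permutations_of_set S)) {L. \<forall>d\<in>D. prefers L d w} =
    measure_pmf.prob (map_pmf rev (pmf_of_set (permutations_of_set S))) {L. \<forall>d\<in>D. prefers L d w}"
    by simp
  also have "\<dots> = measure_pmf.prob (pmf_of_set (permutations_of_set S)) {L. \<forall>d\<in>D. prefers L w d}"
    by (simp add: vimage_def prefers_rev)
  finally show ?thesis using prob_permutation_first[OF assms] by simp
qed

text \<open>Both sides are expanded over subsets \<open>U\<close> of \<open>T\<close>: the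
  probability that all of \<open>U\<close> is ranked above \<open>w\<close> is
  \<open>1 / (card U + 1)\<close>, which is also the integral of \<open>y ^ card U\<close>. The
  variable \<open>y\<close> acts as a uniform score of \<open>w\<close>, given which the others lie
  above \<open>w\<close> independently with probability \<open>y\<close>.\<close>

lemma expectation_prod_above:
  fixes a :: "'b \<Rightarrow> real"
  assumes S: "finite S" "w \<in> S" and \<iota>: "inj_on \<iota> T" "\<iota> ` T \<subseteq> S - {w}"
  shows "measure_pmf.expectation (pmf_of_set (permutations_of_set S))
      (\<lambda>L. \<Prod>i\<in>T. 1 - (if prefers L (\<iota> i) w then a i else 0)) = integral {0..1} (\<lambda>y. \<Prod>i\<in>T. 1 - a i * y)"
proof -
  let ?M = "pmf_of_set (permutations_of_set S)"
  have finT: "finite T" using \<iota> S by (meson finite_Diff finite_imageD finite_subset)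
  have fin: "finite (set_pmf ?M)" using S by simp
  have "(\<lambda>L. \<Prod>i\<in>T. 1 - (if prefers L (\<iota> i) w then a i else 0)) =
    (\<lambda>L. \<Sum>U\<in>Pow T. (\<Prod>i\<in>U. - a i) * indicator {L. \<forall>d\<in>\<iota> ` U. prefers L d w} L)"
  proof
    fix L
    have "(\<Prod>i\<in>T. 1 - (if prefers L (\<iota> i) w then a i else 0)) = (\<Prod>i\<in>T. (if prefers L (\<iota> i) w then - a i else 0) + 1)"
      by (intro prod.cong) auto
    also have "\<dots> = (\<Sum>U\<in>Pow T. \<Prod>i\<in>U. if prefers L (\<iota> i) w then - a i else 0)"
      using finT by (subst prod_add) simp_all
    also have "\<dots> = (\<Sum>U\<in>Pow T. (\<Prod>i\<in>U. - a i) * indicator {L. \<forall>d\<in>\<iota> ` U. prefers L d w} L)"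
    proof (intro sum.cong refl)
      fix U assume "U \<in> Pow T"
      then have "finite U" using finT finite_subset by auto
      then show "(\<Prod>i\<in>U. if prefers L (\<iota> i) w then - a i else 0) =
        (\<Prod>i\<in>U. - a i) * indicator {L. \<forall>d\<in>\<iota> ` U. prefers L d w} L"
        by (auto simp: indicator_def intro!: prod.cong prod_zero)
    qed
    finally show "(\<Prod>i\<in>T. 1 - (if prefers L (\<iota> i) w then a i else 0)) =
      (\<Sum>U\<in>Pow T. (\<Prod>i\<in>U. - a i) * indicator {L. \<forall>d\<in>\<iota> ` U. prefers L d w} L)" .
  qed
  then have "measure_pmf.expectation ?M (\<lambda>L. \<Prod>i\<in>T. 1 - (if prefers L (\<iota> i) w then a i else 0)) =
    (\<Sum>U\<in>Pow T. (\<Prod>i\<in>U. - a i) * measure_pmf.prob ?M {L. \<forall>d\<in>\<iota> ` U. prefers L d w})"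
    by (simp add: integrable_measure_pmf_finite[OF fin] Bochner_Integration.integral_sum)
  also have "\<dots> = (\<Sum>U\<in>Pow T. (\<Prod>i\<in>U. - a i) * (1 / (real (card U) + 1)))"
  proof (intro sum.cong refl)
    fix U assume U: "U \<in> Pow T"
    have "measure_pmf.prob ?M {L. \<forall>d\<in>\<iota> ` U. prefers L d w} = 1 / (real (card (\<iota> ` U)) + 1)"
      using U \<iota> by (intro prob_permutation_last S) auto
    also have "card (\<iota> ` U) = card U" using U \<iota> by (auto intro!: card_image elim: inj_on_subset)
    finally show "(\<Prod>i\<in>U. - a i) * measure_pmf.prob ?M {L. \<forall>d\<in>\<iota> ` U. prefers L d w} =
      (\<Prod>i\<in>U. - a i) * (1 / (real (card U) + 1))" by (rule arg_cong)
  qed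
  finally have lhs: "measure_pmf.expectation ?M (\<lambda>L. \<Prod>i\<in>T. 1 - (if prefers L (\<iota> i) w then a i else 0)) = \<dots>" .
  have "((\<lambda>y. \<Sum>U\<in>Pow T. (\<Prod>i\<in>U. - a i) * y ^ card U) has_integral
     (\<Sum>U\<in>Pow T. (\<Prod>i\<in>U. - a i) * (1 / (real (card U) + 1)))) {0..1}"
  proof (intro has_integral_sum has_integral_mult_right)
    fix U :: "'b set"
    have "((\<lambda>y::real. y ^ card U) has_integral (1 ^ Suc (card U) / real (Suc (card U)) - 0 ^ Suc (card U) / real (Suc (card U)))) {0..1}"
      by (intro fundamental_theorem_of_calculus)
        (auto intro!: derivative_eq_intros simp: has_real_derivative_iff_has_vector_derivative[symmetric] simp del: of_nat_Suc power_Suc)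
    then show "((\<lambda>y::real. y ^ card U) has_integral 1 / (real (card U) + 1)) {0..1}" by (simp add: add.commute)
  qed (use finT in simp)
  moreover have "(\<Sum>U\<in>Pow T. (\<Prod>i\<in>U. - a i) * y ^ card U) = (\<Prod>i\<in>T. 1 - a i * y)" for y
  proof -
    have "(\<Prod>i\<in>T. 1 - a i * y) = (\<Prod>i\<in>T. - a i * y + 1)" by simp
    also have "\<dots> = (\<Sum>U\<in>Pow T. \<Prod>i\<in>U. - a i * y)" using finT by (subst prod_add) simp_all
    finally show ?thesis by (simp only: prod.distrib prod_constant)
  qed
  ultimately show ?thesis using lhs by (simp add: integral_unique)
qed

lemma integral_prod_le_phi:
  fixes a :: "'a \<Rightarrow> real"
  assumes "finite T" "\<And>i. i \<in> T \<Longrightarrow> 0 \<le> a i \<and> a i \<le> 1"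
  shows "integral {0..1} (\<lambda>y. \<Prod>i\<in>T. 1 - a i * y) \<le> phi (\<Sum>i\<in>T. a i)"
  unfolding phi_def
proof (intro integral_le phi_integrable)
  show "(\<lambda>y. \<Prod>i\<in>T. 1 - a i * y) integrable_on {0..1}"
    by (intro integrable_continuous_interval continuous_intros)
  fix y :: real assume y: "y \<in> {0..1}"
  have "(\<Prod>i\<in>T. 1 - a i * y) \<le> (\<Prod>i\<in>T. exp (- (a i * y)))"
  proof (intro prod_mono conjI)
    fix i assume "i \<in> T"
    then show "0 \<le> 1 - a i * y" using assms(2)[of i] y by (simp add: mult_le_one)
    show "1 - a i * y \<le> exp (- (a i * y))" using exp_ge_add_one_self[of "- (a i * y)"] by simp
  qed
  also have "\<dots> = exp (- ((\<Sum>i\<in>T. a i) * y))"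
    using assms by (simp add: exp_sum sum_distrib_right flip: sum_negf)
  finally show "(\<Prod>i\<in>T. 1 - a i * y) \<le> exp (- ((\<Sum>i\<in>T. a i) * y))" .
qed

text \<open>A right Riemann sum dominates the integral of the increasing function
  \<open>x ^ d\<close>. The induction step is Bernoulli's inequality at
  \<open>- 1 / (N + 1)\<close>.\<close>

lemma power_Suc_le_sum_power: "real N ^ Suc d / (real d + 1) \<le> (\<Sum>m=1..N. real m ^ d)"
proof (induction N)
  case (Suc N)
  have "1 + real (Suc d) * (- 1 / real (Suc N)) \<le> (1 + (- 1 / real (Suc N))) ^ Suc d"
    by (rule Bernoulli_inequality) (simp add: field_simps)
  also have "1 + (- 1 / real (Suc N)) = real N / real (Suc N)" by (simp add: field_simps)
  finally have "(1 - real (Suc d) / real (Suc N)) * real (Suc N) ^ Suc d \<le> real N ^ Suc d"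
    by (simp add: power_divide field_simps del: power_Suc of_nat_Suc)
  also have "(1 - real (Suc d) / real (Suc N)) * real (Suc N) ^ Suc d = real (Suc N) ^ Suc d - real (Suc d) * real (Suc N) ^ d"
    by (simp add: field_simps del: of_nat_Suc)
  finally have "real (Suc N) ^ Suc d \<le> real N ^ Suc d + real (Suc N) ^ d * (real d + 1)"
    by (simp only: of_nat_Suc algebra_simps)
  from divide_right_mono[OF this, of "real d + 1"]
  have "real (Suc N) ^ Suc d / (real d + 1) \<le> real N ^ Suc d / (real d + 1) + real (Suc N) ^ d"
    by (simp only: add_divide_distrib) simp
  then show ?case using Suc by simp
qed simp

text \<open>Stands in for \<open>1 / (d + 1) = \<integral> (1 - x) ^ d dx\<close> over \<open>[0, 1]\<close>: with a grid instead of Lebesgue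
  measure, all averages over the cube are finite sums.\<close>

lemma inverse_Suc_le_grid_average:
  assumes "N > 0"
  shows "1 / (real d + 1) \<le> (\<Sum>k<N. (1 - real k / real N) ^ d) / real N"
proof -
  \<comment> \<open>Reflecting the grid turns left endpoints for \<open>(1 - x) ^ d\<close> into
    right endpoints for \<open>x ^ d\<close>, hence an upper sum.\<close>
  have "(\<Sum>k<N. (1 - real k / real N) ^ d) = (\<Sum>m=1..N. (real m / real N) ^ d)"
    by (rule sum.reindex_bij_witness[of _ "\<lambda>m. N - m" "\<lambda>k. N - k"])
      (use assms in \<open>auto simp: of_nat_diff diff_divide_distrib\<close>)
  also have "\<dots> = (\<Sum>m=1..N. real m ^ d) / real N ^ d"
    by (simp add: power_divide sum_divide_distrib)
  finally have "(\<Sum>k<N. (1 - real k / real N) ^ d) / real N = (\<Sum>m=1..N. real m ^ d) / real N ^ Suc d"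
    by simp
  moreover have "1 / (real d + 1) = (real N ^ Suc d / (real d + 1)) / real N ^ Suc d"
    using assms by simp
  ultimately show ?thesis
    using power_Suc_le_sum_power[of N d] by (metis divide_right_mono of_nat_0_le_iff zero_le_power)
qed

section \<open>Expectations over products of finitely supported distributions\<close>

lemma expectation_pair_pmf_finite:
  fixes f :: "'a \<times> 'b \<Rightarrow> real"
  assumes "finite (set_pmf p)" "finite (set_pmf q)"
  shows "measure_pmf.expectation (pair_pmf p q) f =
    measure_pmf.expectation p (\<lambda>a. measure_pmf.expectation q (\<lambda>b. f (a, b)))"
proof -
  have "measure_pmf.expectation (pair_pmf p q) f = (\<Sum>(a, b)\<in>set_pmf p \<times> set_pmf q. f (a, b) * pmf (pair_pmf p q) (a, b))"
    using assms by (subst integral_measure_pmf_real[of "set_pmf p \<times> set_pmf q"]) (auto intro!: sum.cong)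
  also have "\<dots> = (\<Sum>a\<in>set_pmf p. (\<Sum>b\<in>set_pmf q. f (a, b) * pmf q b) * pmf p a)"
    by (simp add: pmf_pair sum_distrib_left sum_distrib_right mult_ac flip: sum.cartesian_product)
  also have "\<dots> = measure_pmf.expectation p (\<lambda>a. measure_pmf.expectation q (\<lambda>b. f (a, b)))"
    using assms by (simp add: integral_measure_pmf_real[of "set_pmf p"] integral_measure_pmf_real[of "set_pmf q"])
  finally show ?thesis .
qed

lemma expectation_swap_pmf_finite:
  fixes f :: "'a \<Rightarrow> 'b \<Rightarrow> real"
  assumes "finite (set_pmf p)" "finite (set_pmf q)"
  shows "measure_pmf.expectation p (\<lambda>a. measure_pmf.expectation q (f a)) =
    measure_pmf.expectation q (\<lambda>b. measure_pmf.expectation p (\<lambda>a. f a b))"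
proof -
  have "measure_pmf.expectation p (\<lambda>a. measure_pmf.expectation q (f a)) =
    (\<Sum>a\<in>set_pmf p. \<Sum>b\<in>set_pmf q. f a b * pmf q b * pmf p a)"
    using assms by (simp add: integral_measure_pmf_real[of "set_pmf p"] integral_measure_pmf_real[of "set_pmf q"] sum_distrib_right)
  also have "\<dots> = (\<Sum>b\<in>set_pmf q. \<Sum>a\<in>set_pmf p. f a b * pmf p a * pmf q b)"
    by (subst sum.swap) (simp only: mult_ac)
  also have "\<dots> = measure_pmf.expectation q (\<lambda>b. measure_pmf.expectation p (\<lambda>a. f a b))"
    using assms by (simp add: integral_measure_pmf_real[of "set_pmf p"] integral_measure_pmf_real[of "set_pmf q"] sum_distrib_right)
  finally show ?thesis .
qed

lemma expectation_mono_pmf: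
  fixes f g :: "'a \<Rightarrow> real"
  assumes "finite (set_pmf p)" "\<And>x. x \<in> set_pmf p \<Longrightarrow> f x \<le> g x"
  shows "measure_pmf.expectation p f \<le> measure_pmf.expectation p g"
  using assms by (intro integral_mono_AE integrable_measure_pmf_finite) (auto simp: AE_measure_pmf_iff)

lemma finite_set_Pi_pmf:
  assumes "finite V" "\<And>x. x \<in> V \<Longrightarrow> finite (set_pmf (q x))"
  shows "finite (set_pmf (Pi_pmf V d q))"
  using assms by (auto simp: set_Pi_pmf)

text \<open>Distinct coordinates are independent. Indexing the factors through the injection
  \<open>\<iota>\<close> lets the edges of a matching, or pairs of edges, address the lists and
  admissibility bits they depend on.\<close>

lemma expectation_prod_Pi_pmf_inj:
  fixes h :: "'t \<Rightarrow> 'a \<Rightarrow> real"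
  assumes V: "finite V" and \<iota>: "inj_on \<iota> T" "\<iota> ` T \<subseteq> V" and q: "finite (set_pmf q)"
    and h: "\<And>t v. t \<in> T \<Longrightarrow> h t v \<ge> 0"
  shows "measure_pmf.expectation (Pi_pmf V d (\<lambda>_. q)) (\<lambda>F. \<Prod>t\<in>T. h t (F (\<iota> t))) =
    (\<Prod>t\<in>T. measure_pmf.expectation q (h t))"
proof -
  \<comment> \<open>Coordinates outside the image of \<open>\<iota>\<close> receive the constant
    factor 1.\<close>
  define H where "H u v = (if u \<in> \<iota> ` T then h (inv_into T \<iota> u) v else 1)" for u v
  have collapse: "(\<Prod>u\<in>V. if u \<in> \<iota> ` T then k (inv_into T \<iota> u) else 1) = (\<Prod>t\<in>T. k t)" for k :: "'t \<Rightarrow> real"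
  proof -
    have "(\<Prod>u\<in>V. if u \<in> \<iota> ` T then k (inv_into T \<iota> u) else 1) = (\<Prod>u\<in>\<iota> ` T. k (inv_into T \<iota> u))"
      using \<iota> V by (simp add: prod.If_cases Int_absorb1 Int_commute)
    also have "\<dots> = (\<Prod>t\<in>T. k t)" using \<iota> by (simp add: prod.reindex)
    finally show ?thesis .
  qed
  have "(\<lambda>F. \<Prod>t\<in>T. h t (F (\<iota> t))) = (\<lambda>F. \<Prod>u\<in>V. H u (F u))"
  proof
    fix F
    have "(\<Prod>t\<in>T. h t (F (\<iota> t))) = (\<Prod>u\<in>V. if u \<in> \<iota> ` T then h (inv_into T \<iota> u) (F (\<iota> (inv_into T \<iota> u))) else 1)"
      by (rule collapse[symmetric])
    also have "\<dots> = (\<Prod>u\<in>V. H u (F u))"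
      by (intro prod.cong) (auto simp: H_def f_inv_into_f)
    finally show "(\<Prod>t\<in>T. h t (F (\<iota> t))) = (\<Prod>u\<in>V. H u (F u))" .
  qed
  then have "measure_pmf.expectation (Pi_pmf V d (\<lambda>_. q)) (\<lambda>F. \<Prod>t\<in>T. h t (F (\<iota> t))) =
    (\<Prod>u\<in>V. measure_pmf.expectation q (H u))"
    by (simp only:, intro expectation_prod_Pi_pmf V integrable_measure_pmf_finite q)
      (auto simp: H_def inv_into_into h)
  also have "\<dots> = (\<Prod>u\<in>V. if u \<in> \<iota> ` T then measure_pmf.expectation q (h (inv_into T \<iota> u)) else 1)"
  proof (intro prod.cong refl)
    fix u
    have "H u = (if u \<in> \<iota> ` T then h (inv_into T \<iota> u) else (\<lambda>_. 1))" by (auto simp: H_def fun_eq_iff)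
    then show "measure_pmf.expectation q (H u) =
      (if u \<in> \<iota> ` T then measure_pmf.expectation q (h (inv_into T \<iota> u)) else 1)" by simp
  qed
  also have "\<dots> = (\<Prod>t\<in>T. measure_pmf.expectation q (h t))" by (rule collapse)
  finally show ?thesis .
qed

section \<open>The probability that a given matching is stable\<close>

abbreviation uniform_lists :: "nat \<Rightarrow> (nat \<Rightarrow> nat list) pmf" where
  "uniform_lists n \<equiv> Pi_pmf {..<n} [] (\<lambda>_. pmf_of_set (permutations_of_set {..<n}))"

abbreviation random_edges :: "nat \<Rightarrow> real \<Rightarrow> (nat \<times> nat \<Rightarrow> bool) pmf" where
  "random_edges n p \<equiv> Pi_pmf ({..<n} \<times> {..<n}) False (\<lambda>_. bernoulli_pmf p)"

lemma set_uniform_lists: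
  "L \<in> set_pmf (uniform_lists n) \<Longrightarrow> i < n \<Longrightarrow> L i \<in> permutations_of_set {..<n}"
  by (auto simp: set_Pi_pmf PiE_dflt_def)

lemma finite_uniform_lists: "finite (set_pmf (uniform_lists n))"
  by (intro finite_set_Pi_pmf) auto

lemma finite_random_edges: "finite (set_pmf (random_edges n p))"
  by (intro finite_set_Pi_pmf) auto

text \<open>Fixes the order of integration: first the men's lists, with everything else given, then
  admissibility, and the women's lists last.\<close>

lemma prob_random_instance:
  "measure_pmf.prob (random_instance n p) {(P, Q, A). R P Q A} =
    measure_pmf.expectation (uniform_lists n) (\<lambda>Q. measure_pmf.expectation (random_edges n p)
      (\<lambda>A. measure_pmf.prob (uniform_lists n) {P. R P Q A}))"
proof -
  have ind: "indicator {(P, Q, A). R P Q A} (P, Q, A) = (indicator {P. R P Q A} P :: real)" for P Q A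
    by (simp add: indicator_def)
  have "measure_pmf.prob (random_instance n p) {(P, Q, A). R P Q A} =
    measure_pmf.expectation (random_instance n p) (indicator {(P, Q, A). R P Q A})"
    by simp
  also have "\<dots> = measure_pmf.expectation (uniform_lists n) (\<lambda>P. measure_pmf.expectation (uniform_lists n)
      (\<lambda>Q. measure_pmf.expectation (random_edges n p) (\<lambda>A. indicator {(P, Q, A). R P Q A} (P, Q, A))))"
    unfolding random_instance_def
    by (simp only: expectation_pair_pmf_finite finite_uniform_lists finite_random_edges set_pair_pmf finite_cartesian_product)
  also have "\<dots> = measure_pmf.expectation (uniform_lists n) (\<lambda>Q. measure_pmf.expectation (random_edges n p)
      (\<lambda>A. measure_pmf.expectation (uniform_lists n) (\<lambda>P. indicator {P. R P Q A} P)))"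
    by (subst expectation_swap_pmf_finite[OF finite_uniform_lists finite_uniform_lists],
        subst expectation_swap_pmf_finite[OF finite_uniform_lists finite_random_edges]) (simp only: ind)
  finally show ?thesis by simp
qed

text \<open>A matching up to admissibility, which stays random.\<close>

locale candidate_matching =
  fixes n :: nat and M :: "(nat \<times> nat) set"
  assumes M: "M \<subseteq> {..<n} \<times> {..<n}" "inj_on fst M" "inj_on snd M"
begin

lemma finite_M: "finite M"
  using M(1) finite_subset by blast

lemma M_lt: "e \<in> M \<Longrightarrow> fst e < n" "e \<in> M \<Longrightarrow> snd e < n"
  using M(1) by auto

text \<open>In a stable \<open>M\<close>, a man matched by \<open>e\<close> must prefer his partner to the partner of every
  edge in \<open>rivals Q A e\<close>.\<close>

definition rivals :: "(nat \<Rightarrow> nat list) \<Rightarrow> (nat \<times> nat \<Rightarrow> bool) \<Rightarrow> nat \<times> nat \<Rightarrow> (nat \<times> nat) set" where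
  "rivals Q A e = {f \<in> M - {e}. A (fst e, snd f) \<and> prefers (Q (snd f)) (fst e) (fst f)}"

lemma stable_imp:
  assumes P: "\<And>i. i < n \<Longrightarrow> P i \<in> permutations_of_set {..<n}"
    and st: "stable n P Q A M"
  shows "\<forall>e\<in>M. A e" "\<forall>e\<in>M. \<forall>d\<in>snd ` rivals Q A e. prefers (P (fst e)) (snd e) d"
proof -
  show "\<forall>e\<in>M. A e" using st by (auto simp: stable_def matching_def)
  show "\<forall>e\<in>M. \<forall>d\<in>snd ` rivals Q A e. prefers (P (fst e)) (snd e) d"
  proof (intro ballI)
    fix e d assume e: "e \<in> M" and "d \<in> snd ` rivals Q A e"
    then obtain f where f: "f \<in> M" "f \<noteq> e" "A (fst e, snd f)" "prefers (Q (snd f)) (fst e) (fst f)" "d = snd f"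
      by (auto simp: rivals_def)
    have ne: "snd f \<noteq> snd e" using e f M(3) by (auto dest: inj_onD)
    have nm: "(fst e, snd f) \<notin> M"
    proof
      assume "(fst e, snd f) \<in> M"
      then have "(fst e, snd f) = e" using e by (intro inj_onD[OF M(2)]) auto
      then show False using ne by (metis snd_conv)
    qed
    have "\<not> blocking n P Q A M (fst e) (snd f)" using st by (simp add: stable_def)
    moreover have "(fst f, snd f) \<in> M" "(fst e, snd e) \<in> M" using e f by auto
    ultimately have "\<not> prefers (P (fst e)) (snd f) (snd e)"
      using M_lt e f nm unfolding blocking_def by blast
    then show "prefers (P (fst e)) (snd e) d"
      using prefers_total[OF P, of "fst e" "snd f" "snd e"] M_lt e f ne by auto
  qed
qed

text \<open>Given \<open>Q\<close> and \<open>A\<close>, the men act independently, and the man of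
  \<open>e\<close> ranks his partner above all rivals with probability
  \<open>1 / (card (rivals Q A e) + 1)\<close>. The grid value \<open>k e / N\<close> acts as the
  score of that partner. Writing the bound as a product over \<open>M \<times> M\<close> makes each
  factor depend on a single bit of \<open>A\<close>; the diagonal records that \<open>M\<close> is
  admissible.\<close>

lemma prob_men_stable_le:
  assumes N: "N > 0"
  shows "measure_pmf.prob (uniform_lists n) {P. stable n P Q A M} \<le>
    (\<Sum>k\<in>PiE M (\<lambda>_. {..<N}). \<Prod>(e, f)\<in>M \<times> M.
       (if e = f then of_bool (A e)
        else if A (fst e, snd f) \<and> prefers (Q (snd f)) (fst e) (fst f) then 1 - real (k e) / real N else 1))
    / real N ^ card M"
proof (cases "\<forall>e\<in>M. A e")
  case False
  \<comment> \<open>With an inadmissible edge \<open>M\<close> is almost surely not stable, and the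
    right-hand side is nonnegative.\<close>
  then have "measure_pmf.prob (uniform_lists n) {P. stable n P Q A M} = 0"
    using stable_imp(1) set_uniform_lists by (subst measure_pmf_zero_iff) blast
  moreover have "k e < N" if "k \<in> PiE M (\<lambda>_. {..<N})" "e \<in> M" for k e
    using that by (metis PiE_mem lessThan_iff)
  ultimately show ?thesis using N
    by (auto intro!: divide_nonneg_nonneg sum_nonneg prod_nonneg simp: less_imp_le)
next
  case True
  let ?M = "pmf_of_set (permutations_of_set {..<n})"
  define h where "h e L = (indicator {L. \<forall>d\<in>snd ` rivals Q A e. prefers L (snd e) d} L :: real)" for e L
  have "measure_pmf.prob (uniform_lists n) {P. stable n P Q A M} =
    measure_pmf.expectation (uniform_lists n) (indicator {P. stable n P Q A M})" by simp
  also have "\<dots> \<le> measure_pmf.expectation (uniform_lists n) (\<lambda>P. \<Prod>e\<in>M. h e (P (fst e)))"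
  proof (intro expectation_mono_pmf finite_uniform_lists)
    fix P assume P: "P \<in> set_pmf (uniform_lists n)"
    show "indicator {P. stable n P Q A M} P \<le> (\<Prod>e\<in>M. h e (P (fst e)))"
    proof (cases "stable n P Q A M")
      case True
      then have "h e (P (fst e)) = 1" if "e \<in> M" for e
        using stable_imp(2)[OF set_uniform_lists[OF P] True] that by (auto simp: h_def)
      then show ?thesis by simp
    qed (auto simp: h_def intro!: prod_nonneg)
  qed
  also have "\<dots> = (\<Prod>e\<in>M. measure_pmf.expectation ?M (h e))"
    by (intro expectation_prod_Pi_pmf_inj) (use M in \<open>auto simp: h_def\<close>)
  also have "\<dots> \<le> (\<Prod>e\<in>M. (\<Sum>k<N. (1 - real k / real N) ^ card (rivals Q A e)) / real N)"
  proof (intro prod_mono conjI)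
    fix e assume e: "e \<in> M"
    have "snd ` rivals Q A e \<subseteq> {..<n} - {snd e}"
      using M_lt M(3) e by (auto simp: rivals_def dest: inj_onD)
    then have "measure_pmf.expectation ?M (h e) = 1 / (real (card (snd ` rivals Q A e)) + 1)"
      using prob_permutation_first[of "{..<n}" "snd e" "snd ` rivals Q A e"] M_lt e by (simp add: h_def[abs_def])
    also have "card (snd ` rivals Q A e) = card (rivals Q A e)"
      by (intro card_image inj_on_subset[OF M(3)]) (auto simp: rivals_def)
    finally show "measure_pmf.expectation ?M (h e) \<le> (\<Sum>k<N. (1 - real k / real N) ^ card (rivals Q A e)) / real N"
      using inverse_Suc_le_grid_average[OF N] by simp
  qed (auto simp: h_def)
  also have "\<dots> = (\<Sum>k\<in>PiE M (\<lambda>_. {..<N}). \<Prod>e\<in>M. (1 - real (k e) / real N) ^ card (rivals Q A e)) / real N ^ card M"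
    using finite_M by (simp add: prod_dividef prod_sum_PiE)
  also have "(\<Sum>k\<in>PiE M (\<lambda>_. {..<N}). \<Prod>e\<in>M. (1 - real (k e) / real N) ^ card (rivals Q A e)) =
    (\<Sum>k\<in>PiE M (\<lambda>_. {..<N}). \<Prod>(e, f)\<in>M \<times> M.
       (if e = f then of_bool (A e)
        else if A (fst e, snd f) \<and> prefers (Q (snd f)) (fst e) (fst f) then 1 - real (k e) / real N else 1))"
    unfolding prod.cartesian_product[symmetric]
  proof (intro sum.cong prod.cong refl)
    fix k e assume e: "e \<in> M"
    have "(\<Prod>f\<in>M. (if e = f then of_bool (A e)
        else if A (fst e, snd f) \<and> prefers (Q (snd f)) (fst e) (fst f) then 1 - real (k e) / real N else 1)) =
      (\<Prod>f\<in>M. if f \<in> rivals Q A e then 1 - real (k e) / real N else 1)"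
      using e True by (intro prod.cong) (auto simp: rivals_def)
    also have "\<dots> = (1 - real (k e) / real N) ^ card (rivals Q A e)"
      using finite_M by (simp add: prod.If_cases) (simp add: rivals_def Int_def conj_ac)
    finally show "(1 - real (k e) / real N) ^ card (rivals Q A e) = (\<Prod>f\<in>M. (if e = f then of_bool (A e)
        else if A (fst e, snd f) \<and> prefers (Q (snd f)) (fst e) (fst f) then 1 - real (k e) / real N else 1))"
      by simp
  qed
  finally show ?thesis .
qed

text \<open>\<open>(e, f) \<mapsto> (fst e, snd f)\<close> is injective on
  \<open>M \<times> M\<close>, so the factors involve independent bits. A diagonal factor averages
  to \<open>p\<close>, any other to \<open>1 - p * x e\<close> or 1. Grouping by \<open>f\<close>
  prepares for the women, as each group involves one woman's list only.\<close>

lemma expectation_edges_eq: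
  fixes x :: "nat \<times> nat \<Rightarrow> real"
  assumes p: "0 \<le> p" "p \<le> 1" and x: "\<And>e. e \<in> M \<Longrightarrow> 0 \<le> x e \<and> x e \<le> 1"
  shows "measure_pmf.expectation (random_edges n p) (\<lambda>A. \<Prod>(e, f)\<in>M \<times> M.
       (if e = f then of_bool (A e)
        else if A (fst e, snd f) \<and> prefers (Q (snd f)) (fst e) (fst f) then 1 - x e else 1)) =
    p ^ card M * (\<Prod>f\<in>M. \<Prod>e\<in>M - {f}. 1 - (if prefers (Q (snd f)) (fst e) (fst f) then p * x e else 0))"
proof -
  define h :: "(nat \<times> nat) \<times> (nat \<times> nat) \<Rightarrow> bool \<Rightarrow> real" where
    "h = (\<lambda>(e, f) a. if e = f then of_bool a
       else if a \<and> prefers (Q (snd f)) (fst e) (fst f) then 1 - x e else 1)"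
  define \<iota> :: "(nat \<times> nat) \<times> (nat \<times> nat) \<Rightarrow> nat \<times> nat" where "\<iota> = (\<lambda>(e, f). (fst e, snd f))"
  have \<iota>: "inj_on \<iota> (M \<times> M)" "\<iota> ` (M \<times> M) \<subseteq> {..<n} \<times> {..<n}"
    using M M_lt by (auto simp: \<iota>_def inj_on_def)
  have "(\<lambda>A. \<Prod>(e, f)\<in>M \<times> M.
       (if e = f then of_bool (A e)
        else if A (fst e, snd f) \<and> prefers (Q (snd f)) (fst e) (fst f) then 1 - x e else 1)) =
    (\<lambda>A. \<Prod>t\<in>M \<times> M. h t (A (\<iota> t)))"
    by (intro ext prod.cong) (auto simp: h_def \<iota>_def)
  then have "measure_pmf.expectation (random_edges n p) (\<lambda>A. \<Prod>(e, f)\<in>M \<times> M.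
       (if e = f then of_bool (A e)
        else if A (fst e, snd f) \<and> prefers (Q (snd f)) (fst e) (fst f) then 1 - x e else 1)) =
     measure_pmf.expectation (random_edges n p) (\<lambda>A. \<Prod>t\<in>M \<times> M. h t (A (\<iota> t)))" by simp
  also have "\<dots> = (\<Prod>t\<in>M \<times> M. measure_pmf.expectation (bernoulli_pmf p) (h t))"
    using x by (intro expectation_prod_Pi_pmf_inj \<iota>) (auto simp: h_def)
  also have "\<dots> = (\<Prod>e\<in>M. \<Prod>f\<in>M. measure_pmf.expectation (bernoulli_pmf p) (h (e, f)))"
    by (subst prod.cartesian_product) (simp add: case_prod_unfold)
  also have "\<dots> = (\<Prod>f\<in>M. \<Prod>e\<in>M. measure_pmf.expectation (bernoulli_pmf p) (h (e, f)))"
    by (rule prod.swap)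
  also have "\<dots> = (\<Prod>f\<in>M. p * (\<Prod>e\<in>M - {f}. 1 - (if prefers (Q (snd f)) (fst e) (fst f) then p * x e else 0)))"
  proof (intro prod.cong refl)
    fix f assume f: "f \<in> M"
    have "(\<Prod>e\<in>M. measure_pmf.expectation (bernoulli_pmf p) (h (e, f))) =
      measure_pmf.expectation (bernoulli_pmf p) (h (f, f)) *
      (\<Prod>e\<in>M - {f}. measure_pmf.expectation (bernoulli_pmf p) (h (e, f)))"
      using f finite_M by (simp add: prod.remove)
    also have "measure_pmf.expectation (bernoulli_pmf p) (h (f, f)) = p"
      using p by (simp add: h_def)
    also have "(\<Prod>e\<in>M - {f}. measure_pmf.expectation (bernoulli_pmf p) (h (e, f))) =
      (\<Prod>e\<in>M - {f}. 1 - (if prefers (Q (snd f)) (fst e) (fst f) then p * x e else 0))"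
      using p by (intro prod.cong) (auto simp: h_def algebra_simps)
    finally show "(\<Prod>e\<in>M. measure_pmf.expectation (bernoulli_pmf p) (h (e, f))) =
      p * (\<Prod>e\<in>M - {f}. 1 - (if prefers (Q (snd f)) (fst e) (fst f) then p * x e else 0))" .
  qed
  finally show ?thesis by (simp add: prod.distrib)
qed

text \<open>The lists of the matched women are independent, so the expectation splits into one
  integral over a score \<open>y\<close> per woman, each bounded by \<open>phi\<close>.\<close>

lemma expectation_women_le:
  fixes x :: "nat \<times> nat \<Rightarrow> real"
  assumes p: "0 \<le> p" "p \<le> 1" and x: "\<And>e. e \<in> M \<Longrightarrow> 0 \<le> x e \<and> x e \<le> 1"
  shows "measure_pmf.expectation (uniform_lists n)
      (\<lambda>Q. \<Prod>f\<in>M. \<Prod>e\<in>M - {f}. 1 - (if prefers (Q (snd f)) (fst e) (fst f) then p * x e else 0))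
    \<le> (exp p * phi (p * (\<Sum>e\<in>M. x e))) ^ card M"
proof -
  let ?M = "pmf_of_set (permutations_of_set {..<n})"
  define h where "h f L = (\<Prod>e\<in>M - {f}. 1 - (if prefers L (fst e) (fst f) then p * x e else 0))" for f L
  have px: "0 \<le> p * x e" "p * x e \<le> 1" "p * x e \<le> p" if "e \<in> M" for e
    using p x[OF that] by (auto simp: mult_le_one mult_left_le)
  have h: "h f L \<ge> 0" for f L
    unfolding h_def
  proof (intro prod_nonneg)
    fix e assume "e \<in> M - {f}"
    then show "0 \<le> 1 - (if prefers L (fst e) (fst f) then p * x e else 0)" using px[of e] by auto
  qed
  have "measure_pmf.expectation (uniform_lists n) (\<lambda>Q. \<Prod>f\<in>M. h f (Q (snd f))) =
    (\<Prod>f\<in>M. measure_pmf.expectation ?M (h f))"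
    by (intro expectation_prod_Pi_pmf_inj) (use M h in auto)
  also have "\<dots> \<le> (\<Prod>f\<in>M. exp p * phi (p * (\<Sum>e\<in>M. x e)))"
  proof (intro prod_mono conjI)
    fix f assume f: "f \<in> M"
    show "0 \<le> measure_pmf.expectation ?M (h f)" using h by (intro Bochner_Integration.integral_nonneg) auto
    have "measure_pmf.expectation ?M (h f) = integral {0..1} (\<lambda>y. \<Prod>e\<in>M - {f}. 1 - (p * x e) * y)"
      unfolding h_def
      by (rule expectation_prod_above) (use M M_lt f in \<open>auto intro: inj_on_subset dest: inj_onD\<close>)
    also have "\<dots> \<le> phi (\<Sum>e\<in>M - {f}. p * x e)"
      using px finite_M by (intro integral_prod_le_phi) auto
    \<comment> \<open>The sum omits \<open>e = f\<close>, a term of size at most \<open>p\<close>;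
      restoring it later costs \<open>exp p\<close>.\<close>
    also have "\<dots> \<le> phi (p * (\<Sum>e\<in>M. x e) - p)"
      using px[OF f] f finite_M by (intro phi_antimono) (simp add: sum.remove[of M f x] distrib_left flip: sum_distrib_left)
    also have "\<dots> \<le> exp p * phi (p * (\<Sum>e\<in>M. x e))" using p by (intro phi_diff_le)
    finally show "measure_pmf.expectation ?M (h f) \<le> exp p * phi (p * (\<Sum>e\<in>M. x e))" .
  qed
  finally show ?thesis by (simp add: h_def)
qed

text \<open>The grid sum is finite and moves out of both expectations; admissibility and then the
  women's lists are averaged out at each grid point. The factor \<open>exp p\<close> per edge
  accumulates to \<open>exp (p * card M)\<close>.\<close>

lemma prob_stable_le:
  assumes p: "0 \<le> p" "p \<le> 1" and N: "N > 0"
  shows "measure_pmf.prob (random_instance n p) {(P, Q, A). stable n P Q A M} \<le>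
    exp (p * real (card M)) * ((\<Sum>k\<in>PiE M (\<lambda>_. {..<N}).
      (p * phi (p * (\<Sum>e\<in>M. real (k e) / real N))) ^ card M) / real N ^ card M)"
proof -
  let ?K = "PiE M (\<lambda>_. {..<N})"
  let ?x = "\<lambda>k e. real (k e) / real N"
  let ?G = "\<lambda>k Q A. \<Prod>(e, f)\<in>M \<times> M. (if e = f then of_bool (A e)
        else if A (fst e, snd f) \<and> prefers (Q (snd f)) (fst e) (fst f) then 1 - ?x k e else 1) :: real"
  let ?F = "\<lambda>k Q. \<Prod>f\<in>M. \<Prod>e\<in>M - {f}. 1 - (if prefers (Q (snd f)) (fst e) (fst f) then p * ?x k e else 0)"
  have x: "0 \<le> ?x k e \<and> ?x k e \<le> 1" if "k \<in> ?K" "e \<in> M" for k e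
    using PiE_mem[OF that] N by simp
  have "measure_pmf.prob (random_instance n p) {(P, Q, A). stable n P Q A M} \<le>
    measure_pmf.expectation (uniform_lists n) (\<lambda>Q. measure_pmf.expectation (random_edges n p)
      (\<lambda>A. (\<Sum>k\<in>?K. ?G k Q A) / real N ^ card M))"
    unfolding prob_random_instance
    by (intro expectation_mono_pmf finite_uniform_lists finite_random_edges prob_men_stable_le N)
  also have "\<dots> = (\<Sum>k\<in>?K. measure_pmf.expectation (uniform_lists n) (\<lambda>Q. measure_pmf.expectation (random_edges n p) (?G k Q))) / real N ^ card M"
    by (simp add: Bochner_Integration.integral_sum integrable_measure_pmf_finite finite_uniform_lists finite_random_edges)
  also have "(\<Sum>k\<in>?K. measure_pmf.expectation (uniform_lists n) (\<lambda>Q. measure_pmf.expectation (random_edges n p) (?G k Q))) =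
    (\<Sum>k\<in>?K. p ^ card M * measure_pmf.expectation (uniform_lists n) (?F k))"
    by (intro sum.cong refl) (subst expectation_edges_eq[OF p x], simp_all)
  also have "\<dots> \<le> (\<Sum>k\<in>?K. p ^ card M * (exp p * phi (p * (\<Sum>e\<in>M. ?x k e))) ^ card M)"
    using p x by (intro sum_mono mult_left_mono expectation_women_le) auto
  also have "\<dots> = (\<Sum>k\<in>?K. exp (p * real (card M)) * (p * phi (p * (\<Sum>e\<in>M. ?x k e))) ^ card M)"
    by (intro sum.cong refl) (simp add: power_mult_distrib exp_of_nat2_mult mult_ac)
  finally show ?thesis
    by (simp add: divide_right_mono sum_distrib_left sum_divide_distrib)
qed

end

section \<open>The number of unmatched men and women\<close>

text \<open>A matching is determined by its set of men, its set of women, and the order in which the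
  women appear when their partners are sorted.\<close>

lemma card_matchings_le:
  "card {M. M \<subseteq> {..<n} \<times> {..<n} \<and> inj_on fst M \<and> inj_on snd M \<and> card M = l} \<le> (n choose l)\<^sup>2 * fact l"
proof -
  let ?S = "{I. I \<subseteq> {..<n} \<and> card I = l}"
  let ?D = "Sigma (?S \<times> ?S) (\<lambda>(I, J). permutations_of_set J)"
  let ?f = "\<lambda>((I, J), ys). set (zip (sorted_list_of_set I) ys) :: (nat \<times> nat) set"
  have fin: "finite ?S" by (rule finite_subset[of _ "Pow {..<n}"]) auto
  have "{M. M \<subseteq> {..<n} \<times> {..<n} \<and> inj_on fst M \<and> inj_on snd M \<and> card M = l} \<subseteq> ?f ` ?D"
  proof
    fix M :: "(nat \<times> nat) set"
    assume "M \<in> {M. M \<subseteq> {..<n} \<times> {..<n} \<and> inj_on fst M \<and> inj_on snd M \<and> card M = l}"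
    then have M: "M \<subseteq> {..<n} \<times> {..<n}" "inj_on fst M" "inj_on snd M" "card M = l" by auto
    then have finM: "finite M" using finite_subset by blast
    define g where "g = snd \<circ> inv_into M fst"
    let ?xs = "sorted_list_of_set (fst ` M)"
    have inv: "inv_into M fst ` fst ` M = M" using M(2) by simp
    have "inj_on g (fst ` M)"
      unfolding g_def using M inv by (intro comp_inj_on inj_on_inv_into) auto
    moreover have gJ: "g ` fst ` M = snd ` M" unfolding g_def image_comp[symmetric] inv ..
    ultimately have perm: "map g ?xs \<in> permutations_of_set (snd ` M)"
      using finM by (auto simp: permutations_of_set_def distinct_map)
    have "set (zip ?xs (map g ?xs)) = (\<lambda>i. (i, g i)) ` fst ` M"
      using finM by (simp add: zip_map2 zip_same_conv_map)
    also have "\<dots> = inv_into M fst ` fst ` M"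
      by (intro image_cong refl) (auto simp: g_def prod_eq_iff f_inv_into_f)
    finally have "M = ?f ((fst ` M, snd ` M), map g ?xs)" using inv by simp
    moreover have "((fst ` M, snd ` M), map g ?xs) \<in> ?D"
      using M perm by (auto simp: card_image)
    ultimately show "M \<in> ?f ` ?D" by (rule image_eqI)
  qed
  moreover have finD: "finite ?D" using fin by (intro finite_SigmaI finite_cartesian_product) (simp_all add: case_prod_unfold)
  ultimately have "card {M. M \<subseteq> {..<n} \<times> {..<n} \<and> inj_on fst M \<and> inj_on snd M \<and> card M = l} \<le> card (?f ` ?D)"
    by (intro card_mono) auto
  also have "\<dots> \<le> card ?D" using finD by (rule card_image_le)
  also have "\<dots> = (\<Sum>(I, J)\<in>?S \<times> ?S. fact l)"
  proof (subst card_SigmaI)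
    show "(\<Sum>a\<in>?S \<times> ?S. card (case a of (I, J) \<Rightarrow> permutations_of_set J)) = (\<Sum>(I, J)\<in>?S \<times> ?S. fact l)"
    proof (intro sum.cong refl)
      fix a assume a: "a \<in> ?S \<times> ?S"
      then have "finite (snd a)" by (intro finite_subset[of "snd a" "{..<n}"]) auto
      then show "card (case a of (I, J) \<Rightarrow> permutations_of_set J) = (case a of (I, J) \<Rightarrow> fact l)"
        using a by auto
    qed
  qed (use fin in \<open>simp_all add: case_prod_unfold\<close>)
  also have "\<dots> = (n choose l)\<^sup>2 * fact l"
    using n_subsets[of "{..<n}" l] by (simp add: case_prod_unfold card_cartesian_product power2_eq_square)
  finally show ?thesis .
qed

text \<open>Union bound over all candidate matchings of size \<open>l\<close>. The \<open>l!\<close>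
  in their number cancels against the \<open>1 / l!\<close> in the bound for a single one.\<close>

lemma prob_exists_stable_le:
  assumes p: "0 < p" "p \<le> 1" and l: "l \<ge> 1" and b: "b \<ge> 1" "p * real b \<le> 1 / 2"
    and q: "q \<ge> 0" "p * real l \<le> q\<^sup>2"
  shows "measure_pmf.prob (random_instance n p) {(P, Q, A). \<exists>M. stable n P Q A M \<and> card M = l} \<le>
    real (n choose l) ^ 2 * (exp (p * real l) * moment_bound q b l)"
proof -
  define \<M> where "\<M> = {M. M \<subseteq> {..<n} \<times> {..<n} \<and> inj_on fst M \<and> inj_on snd M \<and> card M = l}"
  have fin: "finite \<M>" unfolding \<M>_def by (rule finite_subset[of _ "Pow ({..<n} \<times> {..<n})"]) auto
  have "measure_pmf.prob (random_instance n p) {(P, Q, A). \<exists>M. stable n P Q A M \<and> card M = l} \<le>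
    measure_pmf.prob (random_instance n p) (\<Union>M\<in>\<M>. {(P, Q, A). stable n P Q A M})"
    by (intro measure_pmf.finite_measure_mono) (auto simp: \<M>_def stable_def matching_def)
  also have "\<dots> \<le> (\<Sum>M\<in>\<M>. measure_pmf.prob (random_instance n p) {(P, Q, A). stable n P Q A M})"
    using fin by (intro measure_pmf.finite_measure_subadditive_finite) auto
  also have "\<dots> \<le> (\<Sum>M\<in>\<M>. exp (p * real l) * moment_bound q b l / fact l)"
  proof (intro sum_mono)
    fix M assume "M \<in> \<M>"
    then have card_M: "card M = l" and "candidate_matching n M"
      by (auto simp: \<M>_def candidate_matching_def)
    then interpret candidate_matching n M by simp
    \<comment> \<open>\<open>l\<^sup>2\<close> is the coarsest grid that the bound on the
      discretisation error admits.\<close>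
    define S where "S = (\<Sum>k\<in>PiE M (\<lambda>_. {..<l\<^sup>2}).
      (p * phi (p * (\<Sum>e\<in>M. real (k e) / real (l\<^sup>2)))) ^ l) / real (l\<^sup>2) ^ l"
    have "measure_pmf.prob (random_instance n p) {(P, Q, A). stable n P Q A M} \<le> exp (p * real l) * S"
      using prob_stable_le[of p "l\<^sup>2"] p l card_M by (simp add: S_def)
    also have "fact l * S \<le> moment_bound q b l"
      unfolding S_def using finite_M card_M p l b q by (intro grid_average_phi_power_le) auto
    then have "exp (p * real l) * S \<le> exp (p * real l) * (moment_bound q b l / fact l)"
      by (intro mult_left_mono) (simp_all add: field_simps)
    finally show "measure_pmf.prob (random_instance n p) {(P, Q, A). stable n P Q A M} \<le>
      exp (p * real l) * moment_bound q b l / fact l" by simp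
  qed
  also have "\<dots> = real (card \<M>) * (exp (p * real l) * moment_bound q b l / fact l)" by simp
  also have "\<dots> \<le> ((real (n choose l))\<^sup>2 * fact l) * (exp (p * real l) * moment_bound q b l / fact l)"
  proof (intro mult_right_mono)
    have "real (card \<M>) \<le> real ((n choose l)\<^sup>2 * fact l)"
      unfolding \<M>_def of_nat_le_iff by (rule card_matchings_le)
    then show "real (card \<M>) \<le> (real (n choose l))\<^sup>2 * fact l" by simp
  qed (use q in \<open>auto simp: moment_bound_def\<close>)
  finally show ?thesis by simp
qed

lemma set_random_instance:
  assumes "(P, Q, A) \<in> set_pmf (random_instance n p)"
  shows "preference_lists n P Q"
proof -
  have "P \<in> set_pmf (uniform_lists n)" "Q \<in> set_pmf (uniform_lists n)"
    using assms by (simp_all add: random_instance_def)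
  then show ?thesis by unfold_locales (auto dest: set_uniform_lists)
qed

text \<open>On the support all lists are permutations, so a stable matching exists and has
  \<open>stable_size\<close> many edges; a union bound over its possible sizes follows. Positivity
  of \<open>t\<close> excludes size 0.\<close>

lemma prob_stable_size_ge_le:
  assumes p: "0 < p" "p \<le> 1" and b: "b \<ge> 1" "p * real b \<le> 1 / 2"
    and q: "q \<ge> 0" "p * real n \<le> q\<^sup>2" and t: "t > 0"
  shows "measure_pmf.prob (random_instance n p) {(P, Q, A). real (stable_size n P Q A) \<ge> t} \<le>
    (\<Sum>l | l \<le> n \<and> t \<le> real l. real (n choose l) ^ 2 * (exp (p * real l) * moment_bound q b l))"
proof -
  let ?L = "{l. l \<le> n \<and> t \<le> real l}"
  let ?E = "\<lambda>l. {(P, Q, A). \<exists>M. stable n P Q A M \<and> card M = l}"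
  have "measure_pmf.prob (random_instance n p) {(P, Q, A). real (stable_size n P Q A) \<ge> t} \<le>
     measure_pmf.prob (random_instance n p) (\<Union>l\<in>?L. ?E l)"
  proof (rule measure_pmf.finite_measure_mono_AE)
    show "AE \<omega> in random_instance n p. \<omega> \<in> {(P, Q, A). real (stable_size n P Q A) \<ge> t} \<longrightarrow> \<omega> \<in> (\<Union>l\<in>?L. ?E l)"
      unfolding AE_measure_pmf_iff
    proof (intro ballI impI)
      fix \<omega> assume \<omega>: "\<omega> \<in> set_pmf (random_instance n p)" "\<omega> \<in> {(P, Q, A). real (stable_size n P Q A) \<ge> t}"
      obtain P Q A where PQA: "\<omega> = (P, Q, A)" by (cases \<omega>)
      interpret preference_lists n P Q A by (rule set_random_instance[OF \<omega>(1)[unfolded PQA]])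
      obtain M where M: "stable n P Q A M" using stable_exists by blast
      have "card M = card (fst ` M)" "fst ` M \<subseteq> {..<n}"
        using M by (auto simp: stable_def matching_def card_image)
      then have "card M \<le> n" by (metis card_lessThan card_mono finite_lessThan)
      then show "\<omega> \<in> (\<Union>l\<in>?L. ?E l)" using M \<omega>(2) card_stable[OF M] by (auto simp: PQA)
    qed
  qed simp
  also have "\<dots> \<le> (\<Sum>l\<in>?L. measure_pmf.prob (random_instance n p) (?E l))"
    by (intro measure_pmf.finite_measure_subadditive_finite) auto
  also have "\<dots> \<le> (\<Sum>l\<in>?L. real (n choose l) ^ 2 * (exp (p * real l) * moment_bound q b l))"
  proof (intro sum_mono prob_exists_stable_le p b q)
    fix l assume l: "l \<in> ?L"
    then have "real l > 0" using t by auto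
    then show "l \<ge> 1" by simp
    have "p * real l \<le> p * real n" using l p by (intro mult_left_mono) auto
    then show "p * real l \<le> q\<^sup>2" using q by simp
  qed
  finally show ?thesis .
qed

section \<open>Explicit tail bound and its asymptotics\<close>

text \<open>Removes the dependence on \<open>l\<close> when \<open>l \<ge> n / 2\<close>, through
  \<open>1 / 2 \<le> exp (- 1 / 2)\<close> and
  \<open>1 - exp (- q) \<le> exp (- exp (- q))\<close>.\<close>

lemma moment_bound_le:
  assumes "l \<le> n" "n \<ge> 1" "real n \<le> 2 * real l" "0 \<le> q" "real l / real b \<le> r"
  shows "moment_bound q b l \<le> exp 2 * real n * (exp (- real n / 4) + real n * exp r * exp (- (real n * exp (- q) / 2)))"
proof -
  have half: "(1 / 2 :: real) ^ l \<le> exp (- real n / 4)"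
  proof -
    have "1 / 2 \<le> exp (- 1 / 2 :: real)" using exp_ge_add_one_self[of "- 1 / 2 :: real"] by simp
    then have "(1 / 2 :: real) ^ l \<le> exp (- 1 / 2) ^ l" by (intro power_mono) auto
    also have "\<dots> = exp (real l * (- 1 / 2))" by (rule exp_of_nat_mult[symmetric])
    also have "\<dots> \<le> exp (- real n / 4)" using assms by simp
    finally show ?thesis .
  qed
  have pow: "(1 - exp (- q)) ^ l \<le> exp (- (real n * exp (- q) / 2))"
  proof -
    have "(1 - exp (- q)) ^ l \<le> exp (- exp (- q)) ^ l"
      using exp_ge_add_one_self[of "- exp (- q)"] assms by (intro power_mono) auto
    also have "\<dots> = exp (- (real l * exp (- q)))" by (simp flip: exp_of_nat_mult)
    also have "\<dots> \<le> exp (- (real n * exp (- q) / 2))"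
      using mult_right_mono[OF assms(3), of "exp (- q)"] by simp
    finally show ?thesis .
  qed
  have "(1 / 2) ^ l + real l * exp (real l / real b) * (1 - exp (- q)) ^ l \<le>
    exp (- real n / 4) + real n * exp r * exp (- (real n * exp (- q) / 2))"
    using assms by (intro add_mono half mult_mono pow) auto
  then show ?thesis
    using assms unfolding moment_bound_def by (intro mult_mono) auto
qed

text \<open>Counting the \<open>n - l\<close> unmatched persons instead of the matched ones gives
  \<open>n choose l \<le> n ^ (n - l)\<close>.\<close>

lemma binomial_sq_le:
  assumes "l \<le> n" "n \<ge> 1"
  shows "real (n choose l) ^ 2 \<le> exp (2 * (real (n - l) * ln (real n)))"
proof -
  have "n choose l \<le> n ^ (n - l)"
    using binomial_le_pow[of "n - l" n] assms by (simp add: binomial_symmetric[of l n])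
  then have "real (n choose l) \<le> real n ^ (n - l)" by (metis of_nat_le_iff of_nat_power)
  also have "\<dots> = exp (real (n - l) * ln (real n))"
    using assms by (simp only: exp_of_nat_mult) simp
  finally have "real (n choose l) ^ 2 \<le> exp (real (n - l) * ln (real n)) ^ 2"
    by (intro power_mono) auto
  then show ?thesis by (simp add: exp_double)
qed

text \<open>From left to right: the number of sizes \<open>l\<close>, the squared binomial
  coefficient, \<open>exp (p * l)\<close>, and \<open>moment_bound\<close> with
  \<open>n * exp (- q) = n powr a\<close>, where \<open>a = 1 - sqrt c\<close>.\<close>

definition tail_bound :: "real \<Rightarrow> nat \<Rightarrow> real" where
  "tail_bound a n = (real n + 1) * (exp (2 * (real n powr a / ln (real n))) * (exp ((ln (real n))\<^sup>2) *
      (exp 2 * real n * (exp (- real n / 4) + real n * exp (4 * (ln (real n))\<^sup>2) * exp (- (real n powr a / 2))))))"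

lemma prob_stable_size_ge_le_tail_bound:
  fixes n :: nat and p c :: real
  defines "D \<equiv> real n powr (1 - sqrt c) / (ln (real n))\<^sup>2"
  assumes n: "n \<ge> 3" and c: "0 < c" "c < 1" and p: "0 < p" "p \<le> 1" "p \<le> c * (ln (real n))\<^sup>2 / real n"
    and D: "2 * D \<le> real n" "D > 0" and large: "4 * (ln (real n))\<^sup>2 \<le> real n"
  shows "measure_pmf.prob (random_instance n p) {(P, Q, A). real (stable_size n P Q A) \<ge> real n - D} \<le>
    tail_bound (1 - sqrt c) n"
proof -
  define L where "L = ln (real n)"
  \<comment> \<open>Then \<open>q\<^sup>2 = c * L\<^sup>2\<close> bounds \<open>p * n\<close>, while
    \<open>exp (- q)\<close> is \<open>n powr (- sqrt c)\<close>.\<close>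
  define q where "q = sqrt c * L"
  \<comment> \<open>Small enough for \<open>p * b \<le> c / 2\<close>, yet so large that
    \<open>l / b\<close> is at most \<open>4 * L\<^sup>2\<close>.\<close>
  define b where "b = nat \<lfloor>real n / (2 * L\<^sup>2)\<rfloor>"
  have L: "L > 0" using n by (simp add: L_def)
  have q: "q \<ge> 0" using L c by (simp add: q_def)
  have expq: "real n * exp (- q) = real n powr (1 - sqrt c)"
    using n by (simp add: q_def L_def powr_def left_diff_distrib exp_diff exp_minus field_simps)
  \<comment> \<open>As the quotient is at least 2, rounding down loses at most half of it.\<close>
  have x2: "real n / (2 * L\<^sup>2) \<ge> 2" using large L by (simp add: L_def[symmetric] field_simps)
  have b: "real b \<le> real n / (2 * L\<^sup>2)" "real n / (4 * L\<^sup>2) \<le> real b" "b \<ge> 1"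
  proof -
    have fl: "real b = real_of_int \<lfloor>real n / (2 * L\<^sup>2)\<rfloor>" using x2 by (simp add: b_def)
    show "real b \<le> real n / (2 * L\<^sup>2)" unfolding fl by simp
    have "real n / (2 * L\<^sup>2) - 1 \<le> real b" unfolding fl by linarith
    moreover have "real n / (4 * L\<^sup>2) = (real n / (2 * L\<^sup>2)) / 2" by simp
    ultimately show "real n / (4 * L\<^sup>2) \<le> real b" using x2 by linarith
    show "b \<ge> 1" using \<open>real n / (2 * L\<^sup>2) - 1 \<le> real b\<close> x2 by linarith
  qed
  have pn: "p * real n \<le> c * L\<^sup>2" using p n by (simp add: L_def field_simps)
  have "p * real b \<le> (c * L\<^sup>2 / real n) * (real n / (2 * L\<^sup>2))"
    using p b c by (intro mult_mono) (auto simp: L_def)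
  also have "\<dots> = c / 2" using L n by simp
  finally have pb: "p * real b \<le> 1 / 2" using c by simp
  have pq: "p * real n \<le> q\<^sup>2" using pn c by (simp add: q_def power_mult_distrib)
  have "measure_pmf.prob (random_instance n p) {(P, Q, A). real (stable_size n P Q A) \<ge> real n - D} \<le>
    (\<Sum>l | l \<le> n \<and> real n - D \<le> real l. real (n choose l) ^ 2 * (exp (p * real l) * moment_bound q b l))"
    using D n by (intro prob_stable_size_ge_le p b pb q pq) auto
  also have "\<dots> \<le> (\<Sum>l | l \<le> n \<and> real n - D \<le> real l. exp (2 * (real n powr (1 - sqrt c) / L)) * (exp (L\<^sup>2) *
      (exp 2 * real n * (exp (- real n / 4) + real n * exp (4 * L\<^sup>2) * exp (- (real n * exp (- q) / 2))))))"
  proof (intro sum_mono mult_mono)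
    fix l assume "l \<in> {l. l \<le> n \<and> real n - D \<le> real l}"
    then have l: "l \<le> n" "real n - D \<le> real l" by auto
    have "real (n - l) * L \<le> D * L" using l L by (intro mult_right_mono) (auto simp: of_nat_diff)
    \<comment> \<open>One of the two logarithms in \<open>D\<close> survives, so this is of smaller
      order than \<open>n powr (1 - sqrt c)\<close>.\<close>
    also have "D * L = real n powr (1 - sqrt c) / L"
      using L by (simp add: D_def L_def[symmetric] power2_eq_square)
    finally have "exp (2 * (real (n - l) * L)) \<le> exp (2 * (real n powr (1 - sqrt c) / L))" by simp
    moreover have "(real (n choose l))\<^sup>2 \<le> exp (2 * (real (n - l) * L))"
      unfolding L_def using n by (intro binomial_sq_le l) simp
    ultimately show "(real (n choose l))\<^sup>2 \<le> exp (2 * (real n powr (1 - sqrt c) / L))"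
      by (rule order_trans[rotated])
    have "p * real l \<le> p * real n" using l p by (intro mult_left_mono) auto
    also have "\<dots> \<le> c * L\<^sup>2" by (rule pn)
    also have "\<dots> \<le> 1 * L\<^sup>2" using c by (intro mult_right_mono) auto
    finally show "exp (p * real l) \<le> exp (L\<^sup>2)" by simp
    have "real l / real b \<le> real n / (real n / (4 * L\<^sup>2))"
      using b l L n by (intro frac_le) auto
    also have "\<dots> = 4 * L\<^sup>2" using n by simp
    finally have "real l / real b \<le> 4 * L\<^sup>2" .
    then show "moment_bound q b l \<le>
      exp 2 * real n * (exp (- real n / 4) + real n * exp (4 * L\<^sup>2) * exp (- (real n * exp (- q) / 2)))"
      using l n D q by (intro moment_bound_le) auto
    show "0 \<le> moment_bound q b l" using q by (auto simp: moment_bound_def)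
  qed (use q in \<open>auto simp: moment_bound_def\<close>)
  also have "\<dots> = real (card {l. l \<le> n \<and> real n - D \<le> real l}) * (exp (2 * (real n powr (1 - sqrt c) / L)) * (exp (L\<^sup>2) *
      (exp 2 * real n * (exp (- real n / 4) + real n * exp (4 * L\<^sup>2) * exp (- (real n * exp (- q) / 2))))))"
    by simp
  also have "\<dots> \<le> (real n + 1) * (exp (2 * (real n powr (1 - sqrt c) / L)) * (exp (L\<^sup>2) *
      (exp 2 * real n * (exp (- real n / 4) + real n * exp (4 * L\<^sup>2) * exp (- (real n * exp (- q) / 2))))))"
  proof (intro mult_right_mono)
    have "card {l. l \<le> n \<and> real n - D \<le> real l} \<le> card {..n}" by (intro card_mono) auto
    then show "real (card {l. l \<le> n \<and> real n - D \<le> real l}) \<le> real n + 1" by simp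
  qed auto
  finally show ?thesis unfolding tail_bound_def expq by (simp only: L_def)
qed

text \<open>In the exponents, \<open>n powr a / 2\<close> outgrows
  \<open>2 * n powr a / ln n\<close> plus all multiples of \<open>(ln n)\<^sup>2\<close>, and so
  does \<open>n / 4\<close> because \<open>a < 1\<close>.\<close>

lemma tail_bound_super_polynomially_small:
  assumes "0 < a" "a < 1"
  shows "super_polynomially_small (tail_bound a)"
  unfolding super_polynomially_small_def
proof (intro allI impI)
  fix K :: real assume "K > 0"
  then show "tail_bound a \<in> O(\<lambda>n. real n powr (- K))"
    using assms unfolding tail_bound_def[abs_def] by real_asymp
qed

lemma super_polynomially_small_mono:
  assumes "super_polynomially_small g" "\<forall>\<^sub>F n in sequentially. 0 \<le> f n \<and> f n \<le> g n"
  shows "super_polynomially_small f"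
proof -
  have "f \<in> O(g)"
    by (rule bigoI[of _ 1]) (use assms(2) in eventually_elim, auto)
  then show ?thesis using assms(1) unfolding super_polynomially_small_def by (blast intro: landau_o.big_trans)
qed

lemma super_polynomially_small_imp_tendsto_0:
  assumes "super_polynomially_small f"
  shows "f \<longlonglongrightarrow> 0"
proof -
  have "f \<in> O(\<lambda>n. real n powr (- 1))"
    using assms[unfolded super_polynomially_small_def, rule_format, of 1] by (simp only: zero_less_one)
  also have "(\<lambda>n. real n powr (- 1)) \<in> o(\<lambda>_. 1 :: real)" by real_asymp
  finally show ?thesis by (auto dest: smalloD_tendsto)
qed

text \<open>Off the event on the right, every stable matching has fewer than \<open>n - D\<close>
  edges and hence leaves more than \<open>D\<close> persons single on each side.\<close>

lemma prob_unmatched_ge: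
  "measure_pmf.prob (random_instance n p)
           {(P, Q, A). \<forall>M. stable n P Q A M \<longrightarrow>
              real (card ({..<n} - fst ` M)) \<ge> D \<and> real (card ({..<n} - snd ` M)) \<ge> D} \<ge>
   1 - measure_pmf.prob (random_instance n p) {(P, Q, A). real (stable_size n P Q A) \<ge> real n - D}"
   (is "measure_pmf.prob ?R ?U \<ge> 1 - measure_pmf.prob ?R ?E")
proof -
  have "1 - measure_pmf.prob ?R ?E = measure_pmf.prob ?R (- ?E)"
    by (simp add: measure_pmf.prob_compl[of ?E, simplified, symmetric] Compl_eq_Diff_UNIV)
  also have "\<dots> \<le> measure_pmf.prob ?R ?U"
  proof (rule measure_pmf.finite_measure_mono_AE)
    show "AE \<omega> in ?R. \<omega> \<in> - ?E \<longrightarrow> \<omega> \<in> ?U"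
      unfolding AE_measure_pmf_iff
    proof (intro ballI impI)
      fix \<omega> assume \<omega>: "\<omega> \<in> set_pmf ?R" "\<omega> \<in> - ?E"
      obtain P Q A where PQA: "\<omega> = (P, Q, A)" by (cases \<omega>)
      interpret preference_lists n P Q A by (rule set_random_instance[OF \<omega>(1)[unfolded PQA]])
      have "real (card ({..<n} - fst ` M)) \<ge> D \<and> real (card ({..<n} - snd ` M)) \<ge> D"
        if M: "stable n P Q A M" for M
      proof -
        have "real (card M) < real n - D" using \<omega>(2) card_stable[OF M] by (auto simp: PQA)
        moreover have "card (fst ` M) = card M" "card (snd ` M) = card M"
            "fst ` M \<subseteq> {..<n}" "snd ` M \<subseteq> {..<n}"
          using M by (auto simp: stable_def matching_def card_image)
        moreover from this have "card ({..<n} - fst ` M) = n - card M" "card ({..<n} - snd ` M) = n - card M"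
          by (simp_all add: card_Diff_subset finite_subset[OF _ finite_lessThan])
        ultimately show ?thesis by linarith
      qed
      then show "\<omega> \<in> ?U" by (simp add: PQA)
    qed
  qed simp
  finally show ?thesis .
qed

theorem theorem1p5:
  fixes p :: "nat \<Rightarrow> real" and c :: real and \<Delta> :: "nat \<Rightarrow> real"
  assumes "0 < c" and "c < 1"
    and "\<forall>\<^sub>F n in sequentially. 0 < p n \<and> p n < 1"
    and "\<forall>\<^sub>F n in sequentially. p n \<le> c * (ln (real n))\<^sup>2 / real n"
    and "\<And>n. \<Delta> n = real n powr (1 - sqrt c) / (ln (real n))\<^sup>2"
  shows "super_polynomially_small (\<lambda>n. measure_pmf.prob (random_instance n (p n))
           {(P, Q, A). real (stable_size n P Q A) \<ge> real n - \<Delta> n})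
    \<and> (\<lambda>n. measure_pmf.prob (random_instance n (p n))
           {(P, Q, A). \<forall>M. stable n P Q A M \<longrightarrow>
              real (card ({..<n} - fst ` M)) \<ge> \<Delta> n \<and> real (card ({..<n} - snd ` M)) \<ge> \<Delta> n})
        \<longlonglongrightarrow> 1"
proof
  let ?f = "\<lambda>n. measure_pmf.prob (random_instance n (p n)) {(P, Q, A). real (stable_size n P Q A) \<ge> real n - \<Delta> n}"
  have a: "0 < 1 - sqrt c" "1 - sqrt c < 1" using assms(1,2) by auto
  \<comment> \<open>The first growth condition ensures \<open>l \<ge> n / 2\<close> for all relevant
    sizes, the second that the cut-off \<open>b\<close> is at least 1.\<close>
  have "\<forall>\<^sub>F n in sequentially. 2 * (real n powr (1 - sqrt c) / (ln (real n))\<^sup>2) \<le> real n"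
    using a by real_asymp
  moreover have "\<forall>\<^sub>F n in sequentially. 4 * (ln (real n))\<^sup>2 \<le> real n" by real_asymp
  ultimately have "\<forall>\<^sub>F n in sequentially. 0 \<le> ?f n \<and> ?f n \<le> tail_bound (1 - sqrt c) n"
    using assms(3,4) eventually_ge_at_top[of 3]
  proof eventually_elim
    case (elim n)
    then have "0 < real n powr (1 - sqrt c) / (ln (real n))\<^sup>2" by auto
    with elim assms(1,2) show ?case
      unfolding assms(5) by (intro conjI prob_stable_size_ge_le_tail_bound) auto
  qed
  then show small: "super_polynomially_small ?f"
    by (rule super_polynomially_small_mono[OF tail_bound_super_polynomially_small[OF a]])
  have "(\<lambda>n. 1 - ?f n) \<longlonglongrightarrow> 1 - 0"
    by (intro tendsto_diff tendsto_const super_polynomially_small_imp_tendsto_0 small)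
  then have lower: "(\<lambda>n. 1 - ?f n) \<longlonglongrightarrow> 1" by simp
  show "(\<lambda>n. measure_pmf.prob (random_instance n (p n))
           {(P, Q, A). \<forall>M. stable n P Q A M \<longrightarrow>
              real (card ({..<n} - fst ` M)) \<ge> \<Delta> n \<and> real (card ({..<n} - snd ` M)) \<ge> \<Delta> n})
        \<longlonglongrightarrow> 1"
    by (rule tendsto_sandwich[OF always_eventually always_eventually lower tendsto_const])
      (auto simp only: intro!: prob_unmatched_ge measure_pmf.prob_le_1)
qed

end
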